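(* Let $c>1$, $\bar c=(c+1)/(c-1)$. Let $\widehat\beta$ be the Lasso estimator with data-driven penalty level $\lambda=c'\widehat\sigma\Lambda(1-\alpha|X)$, where $c'>c$ is fixed, $c'\ge c/\ell$, and $\ell\le\widehat\sigma/\sigma\le u$ with probability at least $1-\tau$. Let $\widehat T=\operatorname{support}(\widehat\beta)$, $\widehat m=|\widehat T\setminus T|$, and let $\widetilde\beta\in\arg\min_{\beta\in\mathbb R^p}\widehat Q(\beta)$ subject to $\beta_j=0$ for each $j\in\widehat T^c$ (OLS post-Lasso), $\widetilde f_i=x_i'\widetilde\beta$. Suppose $\kappa(\bar c)>0$, $\widetilde\kappa(\widehat m)>0$, and that as $n\to\infty$, $p=p_n\to\infty$, $$c_s^2\lesssim\sigma^2s/n,\quad \phi(\widehat m)\lesssim1,\quad\kappa(\bar c)\gtrsim1,\quad\mu(\widehat m)\lesssim1,\quad\log(1/\alpha)\lesssim\log p,\quad\alpha=o(1),\quad u/\ell\lesssim1,\quad\tau=o(1).$$ Then, as $n$ grows, $$\|\widetilde f-f\|_{\mathbb P_n,2}\lesssim_P\begin{cases}\sigma\sqrt{\dfrac{s\log p}{n}}+c_s,&\text{in general},\\[2mm]\sigma\sqrt{\dfrac{o(s)\log p}{n}}+\sigma\sqrt{\dfrac sn}+c_s,&\text{if }\widehat m=o_P(s)\text{ and }T\subseteq\widehat T\text{ with probability approaching }1,\\[2mm]\sigma\sqrt{s/n}+c_s,&\text{if }T=\widehat T\text{ with probability approaching }1.\end{cases}$$ (In the second case $o(s)$ stands for some deterministic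 sequence $r_n$ with $r_n/s\to0$.)
   Context: Setting. For each $n$ the data satisfy $y_i=f_i+\epsilon_i$, $f_i=f(z_i)$, $i=1,\dots,n$, with $\epsilon_i$ i.i.d. $N(0,\sigma^2)$, $\sigma>0$, and fixed (nonrandom) $z_i$. The vectors $x_i=P(z_i)\in\mathbb R^p$ are fixed technical regressors ($p$ may exceed $n$) normalized so that $\mathbb E_n[x_{\bullet j}^2]=1$ for $j=1,\dots,p$, where $\mathbb E_n[g_\bullet]=\frac1n\sum_{i=1}^n g_i$; $X=[x_1,\dots,x_n]'$. All parameters are implicitly indexed by $n$. Write $\widehat Q(\beta)=\mathbb E_n[(y_\bullet-x_\bullet'\beta)^2]$, $\|\delta\|_{2,n}=(\mathbb E_n[(x_\bullet'\delta)^2])^{1/2}$ and $\|g\|_{\mathbb P_n,2}=(\mathbb E_n[g_\bullet^2])^{1/2}$; $\|\cdot\|,\|\cdot\|_1,\|\cdot\|_\infty$ are the $\ell_2,\ell_1,\ell_\infty$ norms and $\|\cdot\|_0$ counts nonzero components. Oracle. $c_k^2=\min_{\|\beta\|_0\le k}\mathbb E_n[(f_\bullet-x_\bullet'\beta)^2]$, $c_k\ge0$; $s$ is the smallest minimizer of $c_k^2+\sigma^2k/n$ over integers $0\le k\le \min\{p,n\}$; $\beta_0$ is a fixed minimizer of $\mathbb E_n[(f_\bullet-x_\bullet'\beta)^2]$ over $\|\beta\|_0\le s$; $T=\operatorname{support}(\beta_0)$, $|T|=s$; $c_s$ is $c_k$ at $k=s$. $A^c$ is the complement of $A$ in $\{1,\dots,p\}$;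 $\delta_A$ has components $\delta_j$ for $j\in A$ and $0$ otherwise. Score: $S=2\mathbb E_n[x_\bullet\epsilon_\bullet]$. $\Lambda(1-\alpha|X)$ is the $(1-\alpha)$-quantile of $n\|S/\sigma\|_\infty$. $\widehat\sigma$ is a possibly data-driven estimate of $\sigma$; $0<\ell\le1\le u$ and $0\le\tau<1$ are constants possibly depending on $n$. Lasso: $\widehat\beta\in\arg\min_{\beta\in\mathbb R^p}\widehat Q(\beta)+\frac\lambda n\|\beta\|_1$ (if not unique, any solution with minimum support). Restricted eigenvalue: $\kappa(C)=\min\{\sqrt s\,\|\delta\|_{2,n}/\|\delta_T\|_1:\ \|\delta_{T^c}\|_1\le C\|\delta_T\|_1,\ \delta\ne0\}$. Restricted sparse eigenvalues: over $\delta\ne0$ with $\|\delta_{T^c}\|_0\le m$, $\widetilde\kappa(m)^2=\min\|\delta\|_{2,n}^2/\|\delta\|^2$ and $\phi(m)=\max\|\delta\|_{2,n}^2/\|\delta\|^2$; $\mu(m)=\sqrt{\phi(m)}/\widetilde\kappa(m)$. $a\lesssim b$ means $a\le Cb$ for a constant $C>0$ not depending on $n$ (nor on quantities indexed by $n$); $a\gtrsim b$ means $b\lesssim a$; $a\lesssim_Pb$ means $a=O_P(b)$. *)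

theory Defs
  imports "HOL-Probability.Probability" "HOL-Library.Landau_Symbols"
begin

section \<open>Vectors of variable dimension and empirical averages\<close>

text \<open>The dimension \<open>p\<close> varies with the sample size, so an element of \<open>\<real>\<^sup>p\<close> is a function
  on \<open>nat\<close> that vanishes outside \<open>{1..p}\<close>. The regressors are \<open>x i j\<close> for an observation
  \<open>i \<in> {1..n}\<close> and a coordinate \<open>j \<in> {1..p}\<close>.\<close>

definition rvec :: "nat \<Rightarrow> (nat \<Rightarrow> real) set" where
  "rvec p = {\<beta>. \<forall>j. j \<notin> {1..p} \<longrightarrow> \<beta> j = 0}"

definition support :: "(nat \<Rightarrow> real) \<Rightarrow> nat set" where
  "support \<beta> = {j. \<beta> j \<noteq> 0}"

definition l0 :: "(nat \<Rightarrow> real) \<Rightarrow> nat" where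
  "l0 \<beta> = card (support \<beta>)"

definition l1 :: "nat \<Rightarrow> (nat \<Rightarrow> real) \<Rightarrow> real" where
  "l1 p \<beta> = (\<Sum>j=1..p. \<bar>\<beta> j\<bar>)"

definition l2 :: "nat \<Rightarrow> (nat \<Rightarrow> real) \<Rightarrow> real" where
  "l2 p \<beta> = L2_set \<beta> {1..p}"

definition linf :: "nat \<Rightarrow> (nat \<Rightarrow> real) \<Rightarrow> real" where
  "linf p \<beta> = Max ((\<lambda>j. \<bar>\<beta> j\<bar>) ` {1..p})"

definition restr :: "(nat \<Rightarrow> real) \<Rightarrow> nat set \<Rightarrow> nat \<Rightarrow> real" where
  "restr \<delta> A = (\<lambda>j. if j \<in> A then \<delta> j else 0)"

definition dotp :: "nat \<Rightarrow> (nat \<Rightarrow> real) \<Rightarrow> (nat \<Rightarrow> real) \<Rightarrow> real" where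
  "dotp p v \<beta> = (\<Sum>j=1..p. v j * \<beta> j)"

definition En :: "nat \<Rightarrow> (nat \<Rightarrow> real) \<Rightarrow> real" where
  "En n g = (1 / real n) * (\<Sum>i=1..n. g i)"

definition emp_norm :: "nat \<Rightarrow> (nat \<Rightarrow> real) \<Rightarrow> real" where
  "emp_norm n g = sqrt (En n (\<lambda>i. (g i)\<^sup>2))"

definition pred_norm :: "nat \<Rightarrow> nat \<Rightarrow> (nat \<Rightarrow> nat \<Rightarrow> real) \<Rightarrow> (nat \<Rightarrow> real) \<Rightarrow> real" where
  "pred_norm n p x \<delta> = sqrt (En n (\<lambda>i. (dotp p (x i) \<delta>)\<^sup>2))"

text \<open>The least squares criterion for a response \<open>g\<close>: with \<open>g = y\<close> it is the sample criterion
  \<open>Q\<close>, with \<open>g = f\<close> the criterion that defines the oracle.\<close>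

definition lsq :: "nat \<Rightarrow> nat \<Rightarrow> (nat \<Rightarrow> nat \<Rightarrow> real) \<Rightarrow> (nat \<Rightarrow> real) \<Rightarrow> (nat \<Rightarrow> real) \<Rightarrow> real" where
  "lsq n p x g \<beta> = En n (\<lambda>i. (g i - dotp p (x i) \<beta>)\<^sup>2)"


section \<open>The oracle\<close>

definition oracle_err ::
    "nat \<Rightarrow> nat \<Rightarrow> (nat \<Rightarrow> nat \<Rightarrow> real) \<Rightarrow> (nat \<Rightarrow> real) \<Rightarrow> nat \<Rightarrow> real" where
  "oracle_err n p x f k = sqrt (INF \<beta>\<in>{\<beta> \<in> rvec p. l0 \<beta> \<le> k}. lsq n p x f \<beta>)"

definition oracle_index ::
    "nat \<Rightarrow> nat \<Rightarrow> (nat \<Rightarrow> nat \<Rightarrow> real) \<Rightarrow> (nat \<Rightarrow> real) \<Rightarrow> real \<Rightarrow> nat" where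
  "oracle_index n p x f \<sigma> =
     (LEAST k. is_arg_min (\<lambda>k. (oracle_err n p x f k)\<^sup>2 + \<sigma>\<^sup>2 * real k / real n)
                          (\<lambda>k. k \<le> min p n) k)"

definition is_oracle ::
    "nat \<Rightarrow> nat \<Rightarrow> (nat \<Rightarrow> nat \<Rightarrow> real) \<Rightarrow> (nat \<Rightarrow> real) \<Rightarrow> real \<Rightarrow> (nat \<Rightarrow> real) \<Rightarrow> bool" where
  "is_oracle n p x f \<sigma> \<beta> \<longleftrightarrow>
     is_arg_min (lsq n p x f) (\<lambda>\<beta>. \<beta> \<in> rvec p \<and> l0 \<beta> \<le> oracle_index n p x f \<sigma>) \<beta>"


section \<open>Restricted and sparse eigenvalues\<close>

text \<open>The sets of directions below are empty only when \<open>T\<close> is empty (oracle index \<open>0\<close>) or when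
  \<open>p = 0\<close>. A minimum over no direction is read as \<open>1\<close> and a maximum as \<open>0\<close>, so that a
  condition bounding it is then void, as it is with the values \<open>\<infinity>\<close> and \<open>0\<close>.
  Otherwise the minima and maxima are attained and agree with \<open>INF\<close> and \<open>SUP\<close>.\<close>

definition re_dirs :: "nat \<Rightarrow> nat set \<Rightarrow> real \<Rightarrow> (nat \<Rightarrow> real) set" where
  "re_dirs p T C =
     {\<delta> \<in> rvec p. l1 p (restr \<delta> ({1..p} - T)) \<le> C * l1 p (restr \<delta> T) \<and> \<delta> \<noteq> (\<lambda>_. 0)}"

definition restricted_eigenvalue ::
    "nat \<Rightarrow> nat \<Rightarrow> (nat \<Rightarrow> nat \<Rightarrow> real) \<Rightarrow> nat \<Rightarrow> nat set \<Rightarrow> real \<Rightarrow> real" where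
  "restricted_eigenvalue n p x s T C =
     (if re_dirs p T C = {} then 1
      else (INF \<delta>\<in>re_dirs p T C. sqrt (real s) * pred_norm n p x \<delta> / l1 p (restr \<delta> T)))"

definition sparse_dirs :: "nat \<Rightarrow> nat set \<Rightarrow> nat \<Rightarrow> (nat \<Rightarrow> real) set" where
  "sparse_dirs p T m = {\<delta> \<in> rvec p. l0 (restr \<delta> ({1..p} - T)) \<le> m \<and> \<delta> \<noteq> (\<lambda>_. 0)}"

definition kappa_tilde ::
    "nat \<Rightarrow> nat \<Rightarrow> (nat \<Rightarrow> nat \<Rightarrow> real) \<Rightarrow> nat set \<Rightarrow> nat \<Rightarrow> real" where
  "kappa_tilde n p x T m =
     (if sparse_dirs p T m = {} then 1
      else sqrt (INF \<delta>\<in>sparse_dirs p T m. (pred_norm n p x \<delta>)\<^sup>2 / (l2 p \<delta>)\<^sup>2))"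

definition phi ::
    "nat \<Rightarrow> nat \<Rightarrow> (nat \<Rightarrow> nat \<Rightarrow> real) \<Rightarrow> nat set \<Rightarrow> nat \<Rightarrow> real" where
  "phi n p x T m =
     (if sparse_dirs p T m = {} then 0
      else (SUP \<delta>\<in>sparse_dirs p T m. (pred_norm n p x \<delta>)\<^sup>2 / (l2 p \<delta>)\<^sup>2))"

definition mu ::
    "nat \<Rightarrow> nat \<Rightarrow> (nat \<Rightarrow> nat \<Rightarrow> real) \<Rightarrow> nat set \<Rightarrow> nat \<Rightarrow> real" where
  "mu n p x T m = sqrt (phi n p x T m) / kappa_tilde n p x T m"


section \<open>Estimators and penalty level\<close>

definition lasso_obj ::
    "nat \<Rightarrow> nat \<Rightarrow> (nat \<Rightarrow> nat \<Rightarrow> real) \<Rightarrow> (nat \<Rightarrow> real) \<Rightarrow> real \<Rightarrow> (nat \<Rightarrow> real) \<Rightarrow> real" where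
  "lasso_obj n p x y lam \<beta> = lsq n p x y \<beta> + lam / real n * l1 p \<beta>"

definition lasso_solutions ::
    "nat \<Rightarrow> nat \<Rightarrow> (nat \<Rightarrow> nat \<Rightarrow> real) \<Rightarrow> (nat \<Rightarrow> real) \<Rightarrow> real \<Rightarrow> (nat \<Rightarrow> real) set" where
  "lasso_solutions n p x y lam =
     {\<beta>. is_arg_min (lasso_obj n p x y lam) (\<lambda>\<beta>. \<beta> \<in> rvec p) \<beta>}"

definition is_lasso ::
    "nat \<Rightarrow> nat \<Rightarrow> (nat \<Rightarrow> nat \<Rightarrow> real) \<Rightarrow> (nat \<Rightarrow> real) \<Rightarrow> real \<Rightarrow> (nat \<Rightarrow> real) \<Rightarrow> bool" where
  "is_lasso n p x y lam \<beta> \<longleftrightarrow> is_arg_min l0 (\<lambda>\<beta>. \<beta> \<in> lasso_solutions n p x y lam) \<beta>"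

definition is_post_ols ::
    "nat \<Rightarrow> nat \<Rightarrow> (nat \<Rightarrow> nat \<Rightarrow> real) \<Rightarrow> (nat \<Rightarrow> real) \<Rightarrow> nat set \<Rightarrow> (nat \<Rightarrow> real) \<Rightarrow> bool" where
  "is_post_ols n p x y A \<beta> \<longleftrightarrow>
     is_arg_min (lsq n p x y) (\<lambda>\<beta>. \<beta> \<in> rvec p \<and> (\<forall>j\<in>{1..p} - A. \<beta> j = 0)) \<beta>"

definition score :: "nat \<Rightarrow> (nat \<Rightarrow> nat \<Rightarrow> real) \<Rightarrow> (nat \<Rightarrow> real) \<Rightarrow> nat \<Rightarrow> real" where
  "score n x e = (\<lambda>j. 2 * En n (\<lambda>i. x i j * e i))"

definition quantile :: "'a measure \<Rightarrow> ('a \<Rightarrow> real) \<Rightarrow> real \<Rightarrow> real" where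
  "quantile M Z q = Inf {t. q \<le> measure M {\<omega> \<in> space M. Z \<omega> \<le> t}}"

text \<open>The regressors are nonrandom, so conditioning on them has no effect.\<close>

definition penalty_quantile ::
    "'a measure \<Rightarrow> nat \<Rightarrow> nat \<Rightarrow> (nat \<Rightarrow> nat \<Rightarrow> real) \<Rightarrow> (nat \<Rightarrow> 'a \<Rightarrow> real) \<Rightarrow> real \<Rightarrow> real \<Rightarrow> real" where
  "penalty_quantile M n p x eps \<sigma> q =
     quantile M (\<lambda>\<omega>. real n * linf p (\<lambda>j. score n x (\<lambda>i. eps i \<omega>) j / \<sigma>)) q"


section \<open>Asymptotic orders\<close>

definition lesssim :: "(nat \<Rightarrow> real) \<Rightarrow> (nat \<Rightarrow> real) \<Rightarrow> bool" where
  "lesssim a b \<longleftrightarrow> (\<exists>C>0. \<forall>\<^sub>F n in sequentially. a n \<le> C * b n)"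

text \<open>The same relation for a random left-hand side: the constant is nonrandom and the bound
  holds almost surely.\<close>

definition lesssim_as ::
    "(nat \<Rightarrow> 'a measure) \<Rightarrow> (nat \<Rightarrow> 'a \<Rightarrow> real) \<Rightarrow> (nat \<Rightarrow> real) \<Rightarrow> bool" where
  "lesssim_as M a b \<longleftrightarrow> (\<exists>C>0. \<forall>\<^sub>F n in sequentially. AE \<omega> in M n. a n \<omega> \<le> C * b n)"

definition bigO_P ::
    "(nat \<Rightarrow> 'a measure) \<Rightarrow> (nat \<Rightarrow> 'a \<Rightarrow> real) \<Rightarrow> (nat \<Rightarrow> real) \<Rightarrow> bool" where
  "bigO_P M a b \<longleftrightarrow>
     (\<forall>\<eta>>0. \<exists>K>0. \<forall>\<^sub>F n in sequentially.
        measure (M n) {\<omega> \<in> space (M n). \<bar>a n \<omega>\<bar> > K * \<bar>b n\<bar>} \<le> \<eta>)"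

definition smallo_P ::
    "(nat \<Rightarrow> 'a measure) \<Rightarrow> (nat \<Rightarrow> 'a \<Rightarrow> real) \<Rightarrow> (nat \<Rightarrow> real) \<Rightarrow> bool" where
  "smallo_P M a b \<longleftrightarrow>
     (\<forall>\<eta>>0. (\<lambda>n. measure (M n) {\<omega> \<in> space (M n). \<bar>a n \<omega>\<bar> > \<eta> * \<bar>b n\<bar>}) \<longlonglongrightarrow> 0)"

definition wpa1 :: "(nat \<Rightarrow> 'a measure) \<Rightarrow> (nat \<Rightarrow> 'a \<Rightarrow> bool) \<Rightarrow> bool" where
  "wpa1 M E \<longleftrightarrow> (\<lambda>n. measure (M n) {\<omega> \<in> space (M n). E n \<omega>}) \<longlonglongrightarrow> 1"

end

theory Submission
  imports Defs
begin

text \<open>Write \<open>\<delta> = \<beta>til - \<beta>0\<close> and let \<open>S\<close> be the score. The least squares property gives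
  \<open>\<parallel>\<delta>\<parallel>\<^sup>2 \<le> S \<bullet> \<delta> + 2 cs \<parallel>\<delta>\<parallel> + B\<close> in the prediction norm, where \<open>B\<close> vanishes if \<open>T \<subseteq> That\<close> and is
  otherwise bounded by the excess criterion of Lasso, hence by the restricted eigenvalue. No maximal
  inequality over submodels is needed: since \<open>phi \<ge> 1\<close>, the bound on \<open>mu\<close> bounds \<open>kappa_tilde\<close>
  from below, and \<open>S \<bullet> \<delta>\<close> is at most \<open>\<parallel>S\<^sub>T\<parallel> + \<surd>mhat \<parallel>S\<parallel>\<^sub>\<infinity>\<close> times the Euclidean norm of
  \<open>\<delta>\<close>. The first term is of order \<open>\<sigma> \<surd>(s/n)\<close> by Markov's inequality; the second is controlled by
  the penalty level, which a Gaussian union bound puts at \<open>O(\<sigma> \<surd>(n log p))\<close>. Finally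
  \<open>mhat = O(s)\<close> follows from the first-order conditions of Lasso, because the penalty level is at
  least of order \<open>\<sigma> \<surd>n\<close>.\<close>

section \<open>Empirical averages and norms\<close>

text \<open>The randomness is confined to one bad event of probability at most
  \<open>\<alpha> n + \<tau> n + 1 / K\<close>; off it, all estimates are deterministic
  inequalities. Each summand pays for one control: \<alpha> for the score exceeding its own
  quantile, \<tau> for the two-sided bound on \<open>sighat\<close>, \<open>1 / K\<close> for
  Markov's inequality on T. On the good event \<open>c' \<ge> c / l\<close> and
  \<open>l * \<sigma> \<le> sighat\<close> make the penalty exceed the score by the factor c, which
  puts the Lasso error into the cone of the restricted eigenvalue unless it is already at most 2 cs.
  Only \<open>1 / K\<close> does not tend to zero, and K enters only the factor of
  \<sigma>\<surd>(s/n), so a smaller tolerance just costs a larger constant. A lower bound on the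
  penalty without a logarithm suffices for sparsity: since cs is of order \<sigma>\<surd>(s/n), it
  is at most a multiple of L\<surd>s with L = \<lambda>/n, and L cancels. The three rates are one
  inequality with three bounds for mhat: a multiple of s, a deterministic r of order o(s), and
  zero.\<close>

lemma En_add: "En n (\<lambda>i. g i + h i) = En n g + En n h"
  by (simp add: En_def sum.distrib algebra_simps)

lemma En_diff: "En n (\<lambda>i. g i - h i) = En n g - En n h"
  by (simp add: En_def sum_subtractf algebra_simps)

lemma En_cmult: "En n (\<lambda>i. c * g i) = c * En n g"
  by (simp add: En_def sum_distrib_left algebra_simps)

lemma En_nonneg: "(\<And>i. 0 \<le> g i) \<Longrightarrow> 0 \<le> En n g"
  by (simp add: En_def sum_nonneg)

lemma En_sum: "En n (\<lambda>i. \<Sum>j\<in>J. g j i) = (\<Sum>j\<in>J. En n (g j))"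
  unfolding En_def by (subst sum.swap) (simp add: sum_distrib_left)

lemma emp_norm_nonneg [simp]: "0 \<le> emp_norm n g"
  by (simp add: emp_norm_def En_nonneg)

lemma emp_norm_sq: "(emp_norm n g)\<^sup>2 = En n (\<lambda>i. (g i)\<^sup>2)"
  by (simp add: emp_norm_def En_nonneg)

lemma emp_norm_L2_set: "emp_norm n g = L2_set g {1..n} / sqrt (real n)"
  by (simp add: emp_norm_def En_def L2_set_def real_sqrt_divide)

lemma emp_norm_triangle: "emp_norm n (\<lambda>i. g i + h i) \<le> emp_norm n g + emp_norm n h"
proof -
  have "L2_set (\<lambda>i. g i + h i) {1..n} / sqrt (real n)
      \<le> (L2_set g {1..n} + L2_set h {1..n}) / sqrt (real n)"
    by (intro divide_right_mono L2_set_triangle_ineq) simp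
  then show ?thesis
    by (simp add: emp_norm_L2_set add_divide_distrib)
qed

lemma En_Cauchy_Schwarz: "\<bar>En n (\<lambda>i. g i * h i)\<bar> \<le> emp_norm n g * emp_norm n h"
proof -
  have "\<bar>\<Sum>i=1..n. g i * h i\<bar> \<le> (\<Sum>i=1..n. \<bar>g i\<bar> * \<bar>h i\<bar>)"
    by (rule order_trans[OF sum_abs]) (simp add: abs_mult)
  also have "\<dots> \<le> L2_set g {1..n} * L2_set h {1..n}"
    by (rule L2_set_mult_ineq)
  finally have "\<bar>\<Sum>i=1..n. g i * h i\<bar> / real n \<le> L2_set g {1..n} * L2_set h {1..n} / real n"
    by (rule divide_right_mono) simp
  then show ?thesis
    by (simp add: En_def emp_norm_L2_set abs_mult)
qed

lemma pred_norm_emp_norm: "pred_norm n p x \<delta> = emp_norm n (\<lambda>i. dotp p (x i) \<delta>)"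
  by (simp add: pred_norm_def emp_norm_def)

lemma pred_norm_nonneg [simp]: "0 \<le> pred_norm n p x \<delta>"
  by (simp add: pred_norm_emp_norm)

lemma dotp_diff: "dotp p v (\<lambda>j. a j - b j) = dotp p v a - dotp p v b"
  by (simp add: dotp_def algebra_simps sum_subtractf)

text \<open>With \<open>g\<close> the noise, the coefficients on the right are half the score; with
  \<open>g\<close> a residual, they are half the negative gradient of the criterion.\<close>

lemma En_mult_dotp: "En n (\<lambda>i. g i * dotp p (x i) \<delta>) = (\<Sum>j=1..p. En n (\<lambda>i. x i j * g i) * \<delta> j)"
proof -
  have "En n (\<lambda>i. g i * dotp p (x i) \<delta>) = En n (\<lambda>i. \<Sum>j=1..p. \<delta> j * (x i j * g i))"
    by (simp add: dotp_def sum_distrib_left algebra_simps)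
  also have "\<dots> = (\<Sum>j=1..p. En n (\<lambda>i. x i j * g i) * \<delta> j)"
    by (simp add: En_sum En_cmult mult.commute)
  finally show ?thesis .
qed

lemma rvec_finite_support: "\<delta> \<in> rvec p \<Longrightarrow> support \<delta> \<subseteq> {1..p} \<and> finite (support \<delta>)"
proof -
  assume "\<delta> \<in> rvec p"
  then have "support \<delta> \<subseteq> {1..p}" by (auto simp: rvec_def support_def)
  then show ?thesis using finite_subset by blast
qed

lemma l2_nonneg [simp]: "0 \<le> l2 p \<delta>"
  by (simp add: l2_def)

lemma l2_sq: "(l2 p \<delta>)\<^sup>2 = (\<Sum>j=1..p. (\<delta> j)\<^sup>2)"
  by (simp add: l2_def L2_set_def sum_nonneg)

lemma l2_pos: "\<delta> \<in> rvec p \<Longrightarrow> \<delta> \<noteq> (\<lambda>_. 0) \<Longrightarrow> 0 < l2 p \<delta>"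
proof -
  assume a: "\<delta> \<in> rvec p" "\<delta> \<noteq> (\<lambda>_. 0)"
  then obtain j where j: "\<delta> j \<noteq> 0" by auto
  with a(1) have "j \<in> {1..p}" by (auto simp: rvec_def)
  with j have "0 < (\<Sum>j=1..p. (\<delta> j)\<^sup>2)"
    by (intro sum_pos2[of _ j]) auto
  then show ?thesis by (simp add: l2_def L2_set_def)
qed

lemma l1_nonneg [simp]: "0 \<le> l1 p \<delta>"
  by (simp add: l1_def sum_nonneg)

lemma l1_restr_split: "l1 p \<delta> = l1 p (restr \<delta> T) + l1 p (restr \<delta> ({1..p} - T))"
  unfolding l1_def sum.distrib[symmetric] by (rule sum.cong) (auto simp: restr_def)

text \<open>If D exceeded a + b, then b would lie below both D - a and D, and multiplying the two
  inequalities contradicts the assumption. Bounds entered as squares thus come out linearly.\<close>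

lemma quadratic_ineq_bound:
  fixes D a b :: real
  assumes "D\<^sup>2 \<le> a * D + b\<^sup>2" "0 \<le> a" "0 \<le> b"
  shows "D \<le> a + b"
proof (rule ccontr)
  assume "\<not> D \<le> a + b"
  then have "b * b < (D - a) * D"
    using assms by (intro mult_strict_mono') auto
  with assms(1) show False by (simp add: power2_eq_square algebra_simps)
qed

section \<open>Lasso and post-Lasso for a fixed sample\<close>

text \<open>\<open>Smax\<close> is any upper bound for the sup norm of the score. The application
  takes \<sigma> times the penalty quantile over n, so that one number bounds the score and is
  compared with the penalty.\<close>

locale fixed_design =
  fixes n p :: nat and x :: "nat \<Rightarrow> nat \<Rightarrow> real" and g e :: "nat \<Rightarrow> real"
    and \<beta>0 :: "nat \<Rightarrow> real" and T :: "nat set" and cs Smax :: real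
  assumes n_pos: "n \<ge> 1"
    and normalized: "j \<in> {1..p} \<Longrightarrow> En n (\<lambda>i. (x i j)\<^sup>2) = 1"
    and beta0: "\<beta>0 \<in> rvec p"
    and T_def: "T = support \<beta>0"
    and cs_def: "cs = emp_norm n (\<lambda>i. g i - dotp p (x i) \<beta>0)"
    and score_le: "j \<in> {1..p} \<Longrightarrow> \<bar>score n x e j\<bar> \<le> Smax"
    and Smax_nonneg: "0 \<le> Smax"
begin

abbreviation "y \<equiv> \<lambda>i. g i + e i"
abbreviation "pnorm \<equiv> pred_norm n p x"

lemma cs_nonneg: "0 \<le> cs"
  by (simp add: cs_def)

lemma T_subset: "T \<subseteq> {1..p}" and T_finite: "finite T"
  using rvec_finite_support[OF beta0] by (simp_all add: T_def)

section \<open>Expansion of the criterion around the oracle\<close>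

lemma lsq_diff:
  "lsq n p x y \<beta> = lsq n p x y \<beta>0 + (pnorm (\<lambda>j. \<beta> j - \<beta>0 j))\<^sup>2
     - (\<Sum>j=1..p. score n x e j * (\<beta> j - \<beta>0 j))
     - 2 * En n (\<lambda>i. (g i - dotp p (x i) \<beta>0) * dotp p (x i) (\<lambda>j. \<beta> j - \<beta>0 j))"
proof -
  let ?d = "\<lambda>i. dotp p (x i) (\<lambda>j. \<beta> j - \<beta>0 j)" and ?r = "\<lambda>i. g i - dotp p (x i) \<beta>0"
  \<comment> \<open>The residual at \<beta>0 is the noise \<open>e\<close> plus the approximation
    error \<open>?r\<close>; the two cross terms with \<open>?d\<close> are kept apart.\<close>
  have "lsq n p x y \<beta> = En n (\<lambda>i. (y i - dotp p (x i) \<beta>0)\<^sup>2 + (?d i)\<^sup>2 - 2 * (e i * ?d i) - 2 * (?r i * ?d i))"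
    unfolding lsq_def dotp_diff
    by (rule arg_cong[of _ _ "En n"]) (simp add: power2_eq_square algebra_simps fun_eq_iff)
  also have "\<dots> = lsq n p x y \<beta>0 + (pnorm (\<lambda>j. \<beta> j - \<beta>0 j))\<^sup>2
     - 2 * En n (\<lambda>i. e i * ?d i) - 2 * En n (\<lambda>i. ?r i * ?d i)"
    by (simp add: En_diff En_add En_cmult lsq_def pred_norm_emp_norm emp_norm_sq)
  also have "2 * En n (\<lambda>i. e i * ?d i) = (\<Sum>j=1..p. score n x e j * (\<beta> j - \<beta>0 j))"
    unfolding En_mult_dotp by (simp add: score_def sum_distrib_left mult.assoc)
  finally show ?thesis .
qed

text \<open>The slack \<open>b\<close> lets one inequality serve both estimators: for Lasso it is
  the difference of the penalties, for post-Lasso the excess of the criterion.\<close>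

lemma basic_ineq:
  assumes "lsq n p x y \<beta> \<le> lsq n p x y \<beta>0 + b"
  shows "(pnorm (\<lambda>j. \<beta> j - \<beta>0 j))\<^sup>2
    \<le> (\<Sum>j=1..p. score n x e j * (\<beta> j - \<beta>0 j)) + 2 * cs * pnorm (\<lambda>j. \<beta> j - \<beta>0 j) + b"
proof -
  have "En n (\<lambda>i. (g i - dotp p (x i) \<beta>0) * dotp p (x i) (\<lambda>j. \<beta> j - \<beta>0 j))
      \<le> cs * pnorm (\<lambda>j. \<beta> j - \<beta>0 j)"
    using En_Cauchy_Schwarz[of n "\<lambda>i. g i - dotp p (x i) \<beta>0" "\<lambda>i. dotp p (x i) (\<lambda>j. \<beta> j - \<beta>0 j)"]
    by (simp add: cs_def pred_norm_emp_norm)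
  with assms lsq_diff[of \<beta>] show ?thesis by simp
qed

text \<open>On T this is the triangle inequality; off T the oracle vanishes, so each coordinate
  contributes exactly its negative absolute value.\<close>

lemma l1_diff_le:
  "l1 p \<beta>0 - l1 p \<beta>
     \<le> l1 p (restr (\<lambda>j. \<beta> j - \<beta>0 j) T) - l1 p (restr (\<lambda>j. \<beta> j - \<beta>0 j) ({1..p} - T))"
  unfolding l1_def sum_subtractf[symmetric]
  by (rule sum_mono) (auto simp: restr_def T_def support_def)

lemma score_dot_le_l1:
  "(\<Sum>j=1..p. score n x e j * \<delta> j) \<le> Smax * l1 p \<delta>"
  unfolding l1_def sum_distrib_left
proof (rule sum_mono)
  fix j assume "j \<in> {1..p}"
  then have "\<bar>score n x e j\<bar> * \<bar>\<delta> j\<bar> \<le> Smax * \<bar>\<delta> j\<bar>"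
    by (intro mult_right_mono score_le) auto
  then show "score n x e j * \<delta> j \<le> Smax * \<bar>\<delta> j\<bar>"
    by (simp add: abs_mult[symmetric])
qed

section \<open>Restricted and sparse eigenvalues as inequalities\<close>

lemma restricted_eigenvalue_ineq:
  assumes "\<delta> \<in> rvec p" "0 \<le> C" "l1 p (restr \<delta> ({1..p} - T)) \<le> C * l1 p (restr \<delta> T)"
  shows "restricted_eigenvalue n p x s T C * l1 p (restr \<delta> T) \<le> sqrt (real s) * pnorm \<delta>"
proof (cases "\<delta> = (\<lambda>_. 0)")
  case True
  then show ?thesis by (simp add: l1_def restr_def)
next
  case False
  with assms have d: "\<delta> \<in> re_dirs p T C" by (simp add: re_dirs_def)
  have "bdd_below ((\<lambda>\<delta>. sqrt (real s) * pnorm \<delta> / l1 p (restr \<delta> T)) ` re_dirs p T C)"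
    by (rule bdd_belowI2[of _ 0]) simp
  with d have "restricted_eigenvalue n p x s T C \<le> sqrt (real s) * pnorm \<delta> / l1 p (restr \<delta> T)"
    unfolding restricted_eigenvalue_def by (auto intro: cINF_lower)
  then have "restricted_eigenvalue n p x s T C * l1 p (restr \<delta> T)
      \<le> sqrt (real s) * pnorm \<delta> / l1 p (restr \<delta> T) * l1 p (restr \<delta> T)"
    by (rule mult_right_mono) simp
  \<comment> \<open>Only an inequality: if the l1 norm on T vanishes, the quotient is 0 by
    convention and so is the product.\<close>
  also have "\<dots> \<le> sqrt (real s) * pnorm \<delta>" by simp
  finally show ?thesis .
qed

text \<open>Cauchy-Schwarz, with the squared regressors averaging to p by the normalization. The
  bound is crude, but it makes the supremum in \<open>phi\<close> one over a bounded set.\<close>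

lemma pnorm_sq_le:
  assumes "\<delta> \<in> rvec p"
  shows "(pnorm \<delta>)\<^sup>2 \<le> real p * (l2 p \<delta>)\<^sup>2"
proof -
  have "(dotp p (x i) \<delta>)\<^sup>2 \<le> (\<Sum>j=1..p. (x i j)\<^sup>2) * (l2 p \<delta>)\<^sup>2" for i
    using Cauchy_Schwarz_ineq_sum[of "x i" \<delta> "{1..p}"] by (simp add: dotp_def l2_sq)
  then have "(pnorm \<delta>)\<^sup>2 \<le> En n (\<lambda>i. (l2 p \<delta>)\<^sup>2 * (\<Sum>j=1..p. (x i j)\<^sup>2))"
    unfolding pred_norm_emp_norm emp_norm_sq En_def
    by (intro mult_left_mono sum_mono) (auto simp: mult.commute)
  also have "\<dots> = (l2 p \<delta>)\<^sup>2 * real p"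
    by (simp add: En_cmult En_sum normalized)
  finally show ?thesis by (simp add: mult.commute)
qed

lemma pnorm_sq_le_phi:
  assumes "\<delta> \<in> sparse_dirs p T m"
  shows "(pnorm \<delta>)\<^sup>2 \<le> phi n p x T m * (l2 p \<delta>)\<^sup>2"
proof -
  have "bdd_above ((\<lambda>\<delta>. (pnorm \<delta>)\<^sup>2 / (l2 p \<delta>)\<^sup>2) ` sparse_dirs p T m)"
  proof (rule bdd_aboveI2)
    fix d assume d: "d \<in> sparse_dirs p T m"
    then have "0 < l2 p d" by (intro l2_pos) (auto simp: sparse_dirs_def)
    with d show "(pnorm d)\<^sup>2 / (l2 p d)\<^sup>2 \<le> real p"
      by (simp add: divide_le_eq pnorm_sq_le sparse_dirs_def)
  qed
  with assms have "(pnorm \<delta>)\<^sup>2 / (l2 p \<delta>)\<^sup>2 \<le> phi n p x T m"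
    unfolding phi_def by (auto intro: cSUP_upper)
  moreover have "0 < l2 p \<delta>"
    using assms by (intro l2_pos) (auto simp: sparse_dirs_def)
  ultimately show ?thesis by (simp add: divide_le_eq)
qed

lemma kappa_tilde_le_pnorm:
  assumes "\<delta> \<in> sparse_dirs p T m" "0 \<le> kappa_tilde n p x T m"
  shows "kappa_tilde n p x T m * l2 p \<delta> \<le> pnorm \<delta>"
proof -
  have "bdd_below ((\<lambda>\<delta>. (pnorm \<delta>)\<^sup>2 / (l2 p \<delta>)\<^sup>2) ` sparse_dirs p T m)"
    by (rule bdd_belowI2[of _ 0]) simp
  with assms have le: "(INF \<delta>\<in>sparse_dirs p T m. (pnorm \<delta>)\<^sup>2 / (l2 p \<delta>)\<^sup>2) \<le> (pnorm \<delta> / l2 p \<delta>)\<^sup>2"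
    by (auto intro: cINF_lower simp: power_divide)
  have "kappa_tilde n p x T m \<le> pnorm \<delta> / l2 p \<delta>"
    using real_sqrt_le_mono[OF le] assms(1) by (auto simp: kappa_tilde_def)
  moreover have "0 < l2 p \<delta>"
    using assms by (intro l2_pos) (auto simp: sparse_dirs_def)
  ultimately show ?thesis by (simp add: le_divide_eq)
qed

text \<open>Coordinate vectors have empirical norm one by the normalization, so \<open>phi\<close> is at least one and
  the bound on \<open>mu\<close> turns into a lower bound on \<open>kappa_tilde\<close>.\<close>

lemma l2_le_mu_pnorm:
  assumes d: "\<delta> \<in> rvec p" "l0 (restr \<delta> ({1..p} - T)) \<le> m"
    and k: "0 < kappa_tilde n p x T m" and mu: "mu n p x T m \<le> C"
  shows "l2 p \<delta> \<le> C * pnorm \<delta>"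
proof (cases "\<delta> = (\<lambda>_. 0)")
  case True
  then show ?thesis
    by (simp add: l2_def L2_set_def pred_norm_def dotp_def En_def)
next
  case False
  then obtain k where dk: "\<delta> k \<noteq> 0" by auto
  with d have kp: "k \<in> {1..p}" by (auto simp: rvec_def)
  \<comment> \<open>As k lies in the support of \<delta>, this coordinate vector satisfies the
    sparsity constraint with the same m, even for m = 0.\<close>
  define u :: "nat \<Rightarrow> real" where "u = (\<lambda>j. if j = k then 1 else 0)"
  have sup: "support (restr u ({1..p} - T)) \<subseteq> support (restr \<delta> ({1..p} - T))"
    using dk by (auto simp: support_def restr_def u_def)
  have fin: "finite (support (restr \<delta> ({1..p} - T)))"
    by (rule finite_subset[of _ "{1..p}"]) (auto simp: support_def restr_def)
  have "l0 (restr u ({1..p} - T)) \<le> m"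
    using card_mono[OF fin sup] d(2) unfolding l0_def by linarith
  moreover have "u \<noteq> (\<lambda>_. 0)" by (metis u_def zero_neq_one)
  ultimately have us: "u \<in> sparse_dirs p T m"
    using kp by (auto simp: sparse_dirs_def rvec_def u_def)
  have dot: "dotp p (x i) u = x i k" for i
    using kp by (simp add: dotp_def u_def if_distrib cong: if_cong)
  have "(pnorm u)\<^sup>2 = 1"
    using normalized[OF kp] by (simp add: pred_norm_emp_norm emp_norm_sq dot)
  moreover have "(l2 p u)\<^sup>2 = 1"
    using kp by (simp add: l2_sq u_def if_distrib[of "\<lambda>t. t\<^sup>2"] cong: if_cong)
  ultimately have phi: "1 \<le> phi n p x T m"
    using pnorm_sq_le_phi[OF us] by simp
  have "1 \<le> sqrt (phi n p x T m)" using phi by simp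
  also have "\<dots> \<le> C * kappa_tilde n p x T m"
    using mu k by (simp add: mu_def divide_le_eq)
  finally have one: "1 \<le> C * kappa_tilde n p x T m" .
  have ds: "\<delta> \<in> sparse_dirs p T m" using d False by (simp add: sparse_dirs_def)
  have C: "0 \<le> C" using one k by (smt (verit) mult_neg_pos)
  have "1 * l2 p \<delta> \<le> C * kappa_tilde n p x T m * l2 p \<delta>"
    by (rule mult_right_mono[OF one]) simp
  also have "\<dots> \<le> C * pnorm \<delta>"
    using kappa_tilde_le_pnorm[OF ds] k C by (simp add: mult.assoc mult_left_mono)
  finally show ?thesis by simp
qed

section \<open>Prediction rate and sparsity of Lasso\<close>

lemma lasso_l1_bound:
  assumes "\<beta> \<in> lasso_solutions n p x y (real n * L)"
  shows "lsq n p x y \<beta> \<le> lsq n p x y \<beta>0 + L * (l1 p \<beta>0 - l1 p \<beta>)"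
proof -
  have "lasso_obj n p x y (real n * L) \<beta> \<le> lasso_obj n p x y (real n * L) \<beta>0"
    using assms beta0 by (auto simp: lasso_solutions_def is_arg_min_linorder)
  then show ?thesis
    using n_pos by (simp add: lasso_obj_def algebra_simps)
qed

lemma lasso_solution_rvec: "\<beta> \<in> lasso_solutions n p x y lam \<Longrightarrow> \<beta> \<in> rvec p"
  by (simp add: lasso_solutions_def is_arg_min_def)

lemma rvec_diff: "\<beta> \<in> rvec p \<Longrightarrow> (\<lambda>j. \<beta> j - \<beta>0 j) \<in> rvec p"
  using beta0 by (simp add: rvec_def)

text \<open>Here L stands for \<lambda>/n, the scale on which penalty and score are compared. An
  error D of at most 2 cs leaves nothing to prove. Otherwise \<open>D\<^sup>2 - 2 * cs * D\<close>
  is positive, which forces the cone condition; the restricted eigenvalue then turns the l1 norm on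
  T into a multiple of D, and one factor D cancels.\<close>

lemma lasso_rate:
  assumes sol: "\<beta> \<in> lasso_solutions n p x y (real n * L)"
    and c: "c > 1" and L: "c * Smax \<le> L"
    and k0: "0 < k0" "k0 \<le> restricted_eigenvalue n p x s T ((c + 1) / (c - 1))"
  shows "pnorm (\<lambda>j. \<beta> j - \<beta>0 j) \<le> 2 * (L * sqrt (real s) / k0) + 2 * cs"
proof (cases "pnorm (\<lambda>j. \<beta> j - \<beta>0 j) \<le> 2 * cs")
  case True
  moreover have "0 \<le> L" using L c Smax_nonneg by (smt (verit) mult_nonneg_nonneg)
  ultimately show ?thesis using k0(1) by (smt (verit) divide_nonneg_pos mult_nonneg_nonneg of_nat_0_le_iff real_sqrt_ge_zero)
next
  case False
  define \<delta> where "\<delta> = (\<lambda>j. \<beta> j - \<beta>0 j)"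
  define D where "D = pnorm \<delta>"
  define a where "a = l1 p (restr \<delta> T)"
  define b where "b = l1 p (restr \<delta> ({1..p} - T))"
  have D: "D > 2 * cs" "D \<ge> 0" using False by (simp_all add: D_def \<delta>_def)
  have L0: "0 \<le> L" using L c Smax_nonneg by (smt (verit) mult_nonneg_nonneg)
  have ab: "0 \<le> a" "0 \<le> b" by (simp_all add: a_def b_def)
  have "L * (l1 p \<beta>0 - l1 p \<beta>) \<le> L * (a - b)"
    using l1_diff_le[of \<beta>] L0 by (intro mult_left_mono) (simp_all add: a_def b_def \<delta>_def)
  then have "D\<^sup>2 \<le> (\<Sum>j=1..p. score n x e j * \<delta> j) + 2 * cs * D + L * (a - b)"
    using basic_ineq[of \<beta> "L * (a - b)"] lasso_l1_bound[OF sol] by (simp add: D_def \<delta>_def)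
  also have "(\<Sum>j=1..p. score n x e j * \<delta> j) \<le> Smax * (a + b)"
    using score_dot_le_l1[of \<delta>] by (simp add: l1_restr_split[of p \<delta> T] a_def b_def)
  also have "Smax * (a + b) \<le> L / c * (a + b)"
    using L c ab by (intro mult_right_mono) (simp_all add: le_divide_eq mult.commute)
  finally have main: "D\<^sup>2 - 2 * cs * D \<le> L / c * ((c + 1) * a - (c - 1) * b)"
    using c by (simp add: field_simps)
  have "0 < D * (D - 2 * cs)" using D cs_nonneg by (intro mult_pos_pos) auto
  with main have pos: "0 < L / c * ((c + 1) * a - (c - 1) * b)"
    by (simp add: algebra_simps power2_eq_square)
  then have "(c - 1) * b < (c + 1) * a"
    using L0 c by (smt (verit) divide_nonneg_pos mult_nonneg_nonpos)
  then have cone: "b \<le> (c + 1) / (c - 1) * a"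
    using c by (simp add: field_simps)
  have "k0 * a \<le> restricted_eigenvalue n p x s T ((c + 1) / (c - 1)) * a"
    by (rule mult_right_mono) (use k0 ab in auto)
  also have "\<dots> \<le> sqrt (real s) * D"
    unfolding a_def D_def
    by (rule restricted_eigenvalue_ineq)
       (use c cone sol in \<open>auto simp: a_def b_def \<delta>_def intro: rvec_diff lasso_solution_rvec\<close>)
  finally have a_le: "a \<le> sqrt (real s) * D / k0"
    using k0 by (simp add: field_simps)
  have "D\<^sup>2 - 2 * cs * D \<le> L / c * ((c + 1) * a)"
    using main L0 c ab by (smt (verit) divide_nonneg_nonneg mult_left_mono mult_nonneg_nonneg)
  also have "\<dots> = L * ((c + 1) / c) * a" by simp
  \<comment> \<open>\<open>(c + 1) / c \<le> 2\<close> because c > 1. The term with b, being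
    nonpositive, has already been dropped.\<close>
  also have "\<dots> \<le> L * 2 * a"
    using L0 c ab by (intro mult_right_mono mult_left_mono) (auto simp: field_simps)
  also have "\<dots> \<le> L * 2 * (sqrt (real s) * D / k0)"
    using L0 by (intro mult_left_mono a_le) auto
  finally have "D * D \<le> (2 * (L * sqrt (real s) / k0) + 2 * cs) * D"
    by (simp add: power2_eq_square field_simps)
  moreover have "0 < D" using D cs_nonneg by linarith
  ultimately have "D \<le> 2 * (L * sqrt (real s) / k0) + 2 * cs"
    by (simp only: mult_le_cancel_right_pos)
  then show ?thesis by (simp add: D_def \<delta>_def)
qed

text \<open>The first-order condition is obtained by shrinking an active coordinate slightly, which
  avoids subgradients.\<close>

lemma lasso_active_correlation:
  assumes sol: "\<beta> \<in> lasso_solutions n p x y (real n * L)" and k: "\<beta> k \<noteq> 0"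
  shows "L \<le> 2 * \<bar>En n (\<lambda>i. x i k * (y i - dotp p (x i) \<beta>))\<bar>"
proof -
  define G where "G = 2 * En n (\<lambda>i. x i k * (y i - dotp p (x i) \<beta>))"
  have kp: "k \<in> {1..p}" using lasso_solution_rvec[OF sol] k by (auto simp: rvec_def)
  have "L \<le> sgn (\<beta> k) * G + t" if t: "0 < t" "t < \<bar>\<beta> k\<bar>" for t
  proof -
    \<comment> \<open>A move of length t towards zero that does not change the sign, so the l1 norm
      drops by exactly t while the criterion changes by a quadratic in t.\<close>
    define h where "h = - sgn (\<beta> k) * t"
    have hsq: "h\<^sup>2 = t\<^sup>2" using k by (simp add: h_def power_mult_distrib sgn_if)
    define \<gamma> where "\<gamma> = (\<lambda>j. \<beta> j + (if j = k then h else 0))"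
    have "\<gamma> \<in> rvec p" using lasso_solution_rvec[OF sol] kp by (auto simp: \<gamma>_def rvec_def)
    then have le: "lasso_obj n p x y (real n * L) \<beta> \<le> lasso_obj n p x y (real n * L) \<gamma>"
      using sol by (auto simp: lasso_solutions_def is_arg_min_linorder)
    have dot: "dotp p (x i) \<gamma> = dotp p (x i) \<beta> + h * x i k" for i
    proof -
      have "dotp p (x i) \<gamma> = (\<Sum>j=1..p. x i j * \<beta> j + (if j = k then h * x i k else 0))"
        unfolding dotp_def \<gamma>_def by (rule sum.cong) (auto simp: algebra_simps)
      then show ?thesis using kp by (simp add: sum.distrib dotp_def)
    qed
    have "lsq n p x y \<gamma> = En n (\<lambda>i. (y i - dotp p (x i) \<beta>)\<^sup>2
        - (2 * h) * (x i k * (y i - dotp p (x i) \<beta>)) + h\<^sup>2 * (x i k)\<^sup>2)"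
      unfolding lsq_def dot
      by (rule arg_cong[of _ _ "En n"]) (simp add: power2_eq_square algebra_simps fun_eq_iff)
    also have "\<dots> = lsq n p x y \<beta> - h * G + t\<^sup>2"
      using normalized[OF kp] by (simp add: En_diff En_add En_cmult lsq_def G_def hsq)
    finally have q: "lsq n p x y \<gamma> = lsq n p x y \<beta> - h * G + t\<^sup>2" .
    have "l1 p \<gamma> - l1 p \<beta> = (\<Sum>j=1..p. if j = k then - t else 0)"
      unfolding l1_def sum_subtractf[symmetric] using t k
      by (intro sum.cong) (auto simp: \<gamma>_def h_def sgn_if abs_if split: if_splits)
    then have l: "l1 p \<gamma> = l1 p \<beta> - t" using kp by simp
    have "lsq n p x y \<beta> + L * l1 p \<beta> \<le> lsq n p x y \<gamma> + L * l1 p \<gamma>"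
      using le n_pos by (simp add: lasso_obj_def)
    then have "0 \<le> - h * G + t\<^sup>2 - L * t"
      unfolding q l by (simp add: right_diff_distrib)
    then have "L * t \<le> (sgn (\<beta> k) * G + t) * t"
      by (simp add: h_def algebra_simps power2_eq_square)
    with t show ?thesis by simp
  qed
  \<comment> \<open>The bound only weakens as t grows, so small t give it for all t > 0 and the
    error term can be sent to zero.\<close>
  from this[of "min t (\<bar>\<beta> k\<bar> / 2)" for t] have *: "L \<le> sgn (\<beta> k) * G + t" if "0 < t" for t
    using that k by (fastforce simp: min_def split: if_splits)
  have "L \<le> sgn (\<beta> k) * G"
    by (rule field_le_epsilon) (rule *)
  also have "\<dots> \<le> \<bar>G\<bar>" by (auto simp: sgn_if)
  finally show ?thesis by (simp add: G_def abs_mult)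
qed

text \<open>At an active coordinate the doubled residual correlation is at least L in absolute
  value, and noise accounts for at most L/c of it. The rest must come from the noiseless residual
  \<open>gr\<close>, so each false selection adds at least \<open>((c - 1) / c * L)\<^sup>2\<close>
  to the squared norm of the correlation vector v. That norm is in turn limited by
  \<open>phi\<close> and by the size of \<open>gr\<close>.\<close>

lemma lasso_sparsity:
  assumes sol: "\<beta> \<in> lasso_solutions n p x y (real n * L)"
    and c: "c > 1" and L: "c * Smax \<le> L" "0 < L"
    and phi: "phi n p x T (card (support \<beta> - T)) \<le> C" "0 \<le> C"
  shows "(c - 1) * L * sqrt (real (card (support \<beta> - T)))
    \<le> 2 * c * sqrt C * (pnorm (\<lambda>j. \<beta> j - \<beta>0 j) + cs)"
proof -
  define A where "A = support \<beta> - T"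
  have A: "A \<subseteq> {1..p}" "finite A"
    using rvec_finite_support[OF lasso_solution_rvec[OF sol]] by (auto simp: A_def)
  define gr where "gr = (\<lambda>i. g i - dotp p (x i) \<beta>)"
  define v where "v = (\<lambda>j. if j \<in> A then 2 * En n (\<lambda>i. x i j * gr i) else 0)"
  have vr: "v \<in> rvec p" using A by (auto simp: v_def rvec_def)
  have b0: "(c - 1) / c * L \<le> \<bar>v j\<bar>" if j: "j \<in> A" for j
  proof -
    have jp: "j \<in> {1..p}" using A j by auto
    \<comment> \<open>The residual of y is the noise plus \<open>gr\<close>.\<close>
    have eq: "2 * En n (\<lambda>i. x i j * (y i - dotp p (x i) \<beta>)) = score n x e j + v j"
      using j by (simp add: v_def score_def gr_def distrib_left[symmetric] En_add[symmetric] del: distrib_left_numeral)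
        (simp add: algebra_simps)
    have "L \<le> \<bar>2 * En n (\<lambda>i. x i j * (y i - dotp p (x i) \<beta>))\<bar>"
      using lasso_active_correlation[OF sol, of j] j by (simp add: A_def support_def abs_mult)
    then have "L \<le> \<bar>score n x e j + v j\<bar>" unfolding eq .
    moreover have "\<bar>score n x e j\<bar> \<le> L / c"
      using order_trans[OF mult_left_mono[OF score_le[OF jp], of c] L(1)] c
      by (simp add: le_divide_eq mult.commute)
    ultimately have "L - L / c \<le> \<bar>v j\<bar>" by linarith
    then show ?thesis using c by (simp add: field_simps)
  qed
  have vsq: "(l2 p v)\<^sup>2 = (\<Sum>j\<in>A. (v j)\<^sup>2)"
    unfolding l2_sq by (rule sum.mono_neutral_right) (use A in \<open>auto simp: v_def\<close>)
  have "real (card A) * ((c - 1) / c * L)\<^sup>2 = (\<Sum>j\<in>A. ((c - 1) / c * L)\<^sup>2)" by simp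
  also have "\<dots> \<le> (\<Sum>j\<in>A. (v j)\<^sup>2)"
  proof (rule sum_mono)
    fix j assume "j \<in> A"
    then have "((c - 1) / c * L)\<^sup>2 \<le> \<bar>v j\<bar>\<^sup>2"
      using b0 c L by (intro power_mono) auto
    then show "((c - 1) / c * L)\<^sup>2 \<le> (v j)\<^sup>2" by simp
  qed
  finally have "real (card A) * ((c - 1) / c * L)\<^sup>2 \<le> (l2 p v)\<^sup>2" by (simp add: vsq)
  then have "sqrt (real (card A) * ((c - 1) / c * L)\<^sup>2) \<le> sqrt ((l2 p v)\<^sup>2)"
    by (rule real_sqrt_le_mono)
  then have lower: "(c - 1) / c * L * sqrt (real (card A)) \<le> l2 p v"
    using c L by (simp add: real_sqrt_mult mult.commute)
  have upper: "l2 p v \<le> 2 * sqrt C * emp_norm n gr"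
  proof (cases "v = (\<lambda>_. 0)")
    case True
    then have "l2 p v = 0" by (simp add: l2_def L2_set_def)
    with phi(2) show ?thesis by simp
  next
    case False
    have supp: "support (restr v ({1..p} - T)) \<subseteq> A"
      by (auto simp: support_def restr_def v_def)
    have vs: "v \<in> sparse_dirs p T (card A)"
      using vr False card_mono[OF A(2) supp] by (simp add: sparse_dirs_def l0_def)
    have "(pnorm v)\<^sup>2 \<le> phi n p x T (card A) * (l2 p v)\<^sup>2" by (rule pnorm_sq_le_phi[OF vs])
    also have "\<dots> \<le> C * (l2 p v)\<^sup>2" using phi by (intro mult_right_mono) (simp_all add: A_def)
    finally have pv: "pnorm v \<le> sqrt C * l2 p v"
      using real_sqrt_le_mono by (fastforce simp: real_sqrt_mult)
    \<comment> \<open>Pairing v with itself reduces the norm to a correlation of \<open>gr\<close>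
      with the fit of v; Cauchy-Schwarz and \<open>phi\<close> then give back one factor
      \<open>l2 p v\<close>, which cancels.\<close>
    have "(l2 p v)\<^sup>2 = 2 * (\<Sum>j=1..p. En n (\<lambda>i. x i j * gr i) * v j)"
      unfolding l2_sq sum_distrib_left
      by (rule sum.cong) (auto simp: v_def power2_eq_square)
    also have "\<dots> = 2 * En n (\<lambda>i. gr i * dotp p (x i) v)" by (simp add: En_mult_dotp)
    also have "\<dots> \<le> 2 * (emp_norm n gr * pnorm v)"
      using En_Cauchy_Schwarz[of n gr "\<lambda>i. dotp p (x i) v"] by (simp add: pred_norm_emp_norm)
    also have "\<dots> \<le> 2 * (emp_norm n gr * (sqrt C * l2 p v))"
      by (intro mult_left_mono pv) auto
    finally have "l2 p v * l2 p v \<le> 2 * sqrt C * emp_norm n gr * l2 p v"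
      by (simp add: power2_eq_square algebra_simps)
    then show ?thesis using l2_pos[OF vr False] by (simp only: mult_le_cancel_right_pos)
  qed
  have "emp_norm n gr = emp_norm n (\<lambda>i. (g i - dotp p (x i) \<beta>0) + dotp p (x i) (\<lambda>j. \<beta>0 j - \<beta> j))"
    by (simp add: gr_def dotp_diff)
  also have "\<dots> \<le> cs + emp_norm n (\<lambda>i. dotp p (x i) (\<lambda>j. \<beta>0 j - \<beta> j))"
    unfolding cs_def by (rule emp_norm_triangle)
  also have "emp_norm n (\<lambda>i. dotp p (x i) (\<lambda>j. \<beta>0 j - \<beta> j)) = pnorm (\<lambda>j. \<beta> j - \<beta>0 j)"
    by (simp add: pred_norm_emp_norm emp_norm_def dotp_diff power2_commute)
  finally have gr: "emp_norm n gr \<le> pnorm (\<lambda>j. \<beta> j - \<beta>0 j) + cs" by simp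
  have "(c - 1) / c * L * sqrt (real (card A)) \<le> 2 * sqrt C * (pnorm (\<lambda>j. \<beta> j - \<beta>0 j) + cs)"
    using lower upper mult_left_mono[OF gr, of "2 * sqrt C"] phi(2) by simp
  then show ?thesis using c by (simp add: A_def field_simps)
qed

section \<open>Least squares on the selected model\<close>

lemma score_dot_le_l2:
  assumes A: "A \<subseteq> {1..p}" and \<delta>: "support \<delta> \<subseteq> T \<union> A"
    and V: "(\<Sum>j\<in>T. (score n x e j)\<^sup>2) \<le> V\<^sup>2" "0 \<le> V"
  shows "(\<Sum>j=1..p. score n x e j * \<delta> j) \<le> (V + sqrt (real (card (A - T))) * Smax) * l2 p \<delta>"
proof -
  let ?S = "score n x e"
  have fA: "finite (A - T)" using A by (meson finite_Diff finite_atLeastAtMost finite_subset)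
  have l2_mono: "L2_set \<delta> B \<le> l2 p \<delta>" if "B \<subseteq> {1..p}" for B
    unfolding l2_def L2_set_def using that by (intro real_sqrt_le_mono sum_mono2) auto
  have "(\<Sum>j=1..p. ?S j * \<delta> j) = (\<Sum>j\<in>T \<union> (A - T). ?S j * \<delta> j)"
    by (rule sum.mono_neutral_right) (use A \<delta> T_subset in \<open>auto simp: support_def\<close>)
  also have "\<dots> = (\<Sum>j\<in>T. ?S j * \<delta> j) + (\<Sum>j\<in>A - T. ?S j * \<delta> j)"
    by (rule sum.union_disjoint) (use T_finite fA in auto)
  \<comment> \<open>On T the Euclidean norm of the score is kept, since T does not depend on the
    sample and a moment bound without logarithm will be available. Off T the coordinates are
    selected by the data, so the sup norm is used there.\<close>
  also have "(\<Sum>j\<in>T. ?S j * \<delta> j) \<le> V * l2 p \<delta>"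
  proof -
    have "(\<Sum>j\<in>T. ?S j * \<delta> j) \<le> (\<Sum>j\<in>T. \<bar>?S j\<bar> * \<bar>\<delta> j\<bar>)"
      by (intro sum_mono) (simp add: abs_mult[symmetric])
    also have "\<dots> \<le> L2_set ?S T * L2_set \<delta> T" by (rule L2_set_mult_ineq)
    also have "\<dots> \<le> V * l2 p \<delta>"
      using V l2_mono[OF T_subset] real_sqrt_le_mono[OF V(1)]
      by (intro mult_mono) (auto simp: L2_set_def sum_nonneg)
    finally show ?thesis .
  qed
  also have "(\<Sum>j\<in>A - T. ?S j * \<delta> j) \<le> sqrt (real (card (A - T))) * Smax * l2 p \<delta>"
  proof -
    have "(\<Sum>j\<in>A - T. ?S j * \<delta> j) \<le> (\<Sum>j\<in>A - T. \<bar>Smax\<bar> * \<bar>\<delta> j\<bar>)"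
    proof (rule sum_mono)
      fix j assume "j \<in> A - T"
      then have "\<bar>?S j\<bar> * \<bar>\<delta> j\<bar> \<le> \<bar>Smax\<bar> * \<bar>\<delta> j\<bar>"
        using score_le[of j] A by (intro mult_right_mono) auto
      then show "?S j * \<delta> j \<le> \<bar>Smax\<bar> * \<bar>\<delta> j\<bar>" by (simp add: abs_mult[symmetric])
    qed
    also have "\<dots> \<le> L2_set (\<lambda>_. Smax) (A - T) * L2_set \<delta> (A - T)" by (rule L2_set_mult_ineq)
    also have "\<dots> \<le> sqrt (real (card (A - T))) * Smax * l2 p \<delta>"
      using A Smax_nonneg fA
      by (intro mult_mono l2_mono) (auto simp: L2_set_def real_sqrt_mult sum_nonneg)
    finally show ?thesis .
  qed
  finally show ?thesis by (simp add: algebra_simps)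
qed

text \<open>Only errors with at least as much l1 mass on T as off T can make the penalty difference
  positive, and those satisfy the cone condition. The bound is put as a square to fit
  \<open>quadratic_ineq_bound\<close>.\<close>

lemma lasso_lsq_excess:
  assumes sol: "\<beta> \<in> lasso_solutions n p x y (real n * L)"
    and c: "c > 1" and L: "c * Smax \<le> L"
    and k0: "0 < k0" "k0 \<le> restricted_eigenvalue n p x s T ((c + 1) / (c - 1))"
  shows "L * (l1 p \<beta>0 - l1 p \<beta>) \<le> (2 * (L * sqrt (real s) / k0) + cs)\<^sup>2"
proof -
  define \<delta> where "\<delta> = (\<lambda>j. \<beta> j - \<beta>0 j)"
  define w where "w = L * sqrt (real s) / k0"
  define a where "a = l1 p (restr \<delta> T)"
  define b where "b = l1 p (restr \<delta> ({1..p} - T))"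
  have L0: "0 \<le> L" using L c Smax_nonneg by (smt (verit) mult_nonneg_nonneg)
  have ab: "0 \<le> a" "0 \<le> b" by (simp_all add: a_def b_def)
  have w0: "0 \<le> w" using L0 k0 by (simp add: w_def)
  have le: "L * (l1 p \<beta>0 - l1 p \<beta>) \<le> L * (a - b)"
    using l1_diff_le[of \<beta>] L0 by (intro mult_left_mono) (simp_all add: a_def b_def \<delta>_def)
  show ?thesis
  proof (cases "b \<le> a")
    case False
    then have "L * (a - b) \<le> 0" using L0 by (simp add: mult_nonneg_nonpos)
    with le show ?thesis by (smt (verit) zero_le_power2)
  next
    case True
    \<comment> \<open>The cone constant exceeds 1.\<close>
    have "1 * a \<le> (c + 1) / (c - 1) * a"
      by (rule mult_right_mono) (use c ab in auto)
    with True have cone: "b \<le> (c + 1) / (c - 1) * a" by simp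
    have "k0 * a \<le> restricted_eigenvalue n p x s T ((c + 1) / (c - 1)) * a"
      by (rule mult_right_mono) (use k0 ab in auto)
    also have "\<dots> \<le> sqrt (real s) * pnorm \<delta>"
      unfolding a_def
      by (rule restricted_eigenvalue_ineq)
         (use c cone sol in \<open>auto simp: a_def b_def \<delta>_def intro: rvec_diff lasso_solution_rvec\<close>)
    finally have "a \<le> sqrt (real s) * pnorm \<delta> / k0"
      using k0 by (simp add: field_simps)
    then have "L * a \<le> L * (sqrt (real s) * pnorm \<delta> / k0)"
      by (rule mult_left_mono) (rule L0)
    also have "\<dots> = w * pnorm \<delta>" by (simp add: w_def)
    also have "\<dots> \<le> w * (2 * w + 2 * cs)"
      using lasso_rate[OF sol c L k0] w0 by (intro mult_left_mono) (simp_all add: w_def \<delta>_def)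
    also have "\<dots> \<le> (2 * w + cs)\<^sup>2"
      using w0 cs_nonneg by (simp add: power2_eq_square algebra_simps)
    finally show ?thesis
      using le L0 ab by (simp add: w_def algebra_simps) (smt (verit) mult_nonneg_nonneg)
  qed
qed

text \<open>The selected set \<open>A\<close> and the excess bound \<open>B\<close> are arbitrary,
  so no property of Lasso enters. The bound on \<open>mu\<close> trades the Euclidean norm for the
  prediction norm, which leaves a quadratic inequality in \<open>pnorm \<delta>\<close>
  alone.\<close>

lemma post_ols_rate:
  assumes post: "is_post_ols n p x y A \<beta>" and A: "A \<subseteq> {1..p}"
    and le: "lsq n p x y \<beta> \<le> lsq n p x y \<beta>0 + B\<^sup>2" "0 \<le> B"
    and k: "0 < kappa_tilde n p x T (card (A - T))" and mu: "mu n p x T (card (A - T)) \<le> C" "0 \<le> C"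
    and V: "(\<Sum>j\<in>T. (score n x e j)\<^sup>2) \<le> V\<^sup>2" "0 \<le> V"
  shows "emp_norm n (\<lambda>i. dotp p (x i) \<beta> - g i)
    \<le> C * (V + sqrt (real (card (A - T))) * Smax) + 3 * cs + B"
proof -
  define \<delta> where "\<delta> = (\<lambda>j. \<beta> j - \<beta>0 j)"
  define m where "m = card (A - T)"
  have \<beta>: "\<beta> \<in> rvec p" "\<forall>j\<in>{1..p} - A. \<beta> j = 0"
    using post by (auto simp: is_post_ols_def is_arg_min_def)
  have supp: "support \<delta> \<subseteq> T \<union> A"
    using \<beta> beta0 by (fastforce simp: support_def \<delta>_def T_def rvec_def)
  have dr: "\<delta> \<in> rvec p" unfolding \<delta>_def by (rule rvec_diff) (rule \<beta>)
  have fA: "finite (A - T)" using A by (meson finite_Diff finite_atLeastAtMost finite_subset)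
  have "support (restr \<delta> ({1..p} - T)) \<subseteq> A - T"
    using supp by (auto simp: support_def restr_def)
  then have "l0 (restr \<delta> ({1..p} - T)) \<le> m"
    unfolding l0_def m_def by (rule card_mono[OF fA])
  then have l2: "l2 p \<delta> \<le> C * pnorm \<delta>"
    using l2_le_mu_pnorm[OF dr, of m C] k mu by (simp add: m_def)
  let ?a = "V + sqrt (real m) * Smax"
  have a0: "0 \<le> ?a" using V Smax_nonneg by simp
  have "(pnorm \<delta>)\<^sup>2 \<le> ?a * l2 p \<delta> + 2 * cs * pnorm \<delta> + B\<^sup>2"
    using basic_ineq[OF le(1)] score_dot_le_l2[OF A supp V] by (simp add: \<delta>_def m_def)
  also have "\<dots> \<le> ?a * (C * pnorm \<delta>) + 2 * cs * pnorm \<delta> + B\<^sup>2"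
    using mult_left_mono[OF l2 a0] by simp
  finally have "(pnorm \<delta>)\<^sup>2 \<le> (C * ?a + 2 * cs) * pnorm \<delta> + B\<^sup>2"
    by (simp add: algebra_simps)
  then have D: "pnorm \<delta> \<le> C * ?a + 2 * cs + B"
    by (rule quadratic_ineq_bound) (use a0 mu cs_nonneg le in auto)
  \<comment> \<open>Two of the three cs come from the cross term in the basic inequality; the third
    is the passage from the oracle fit to \<open>g\<close>.\<close>
  have "emp_norm n (\<lambda>i. dotp p (x i) \<beta> - g i)
      = emp_norm n (\<lambda>i. dotp p (x i) \<delta> + (dotp p (x i) \<beta>0 - g i))"
    by (simp add: \<delta>_def dotp_diff)
  also have "\<dots> \<le> pnorm \<delta> + emp_norm n (\<lambda>i. dotp p (x i) \<beta>0 - g i)"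
    unfolding pred_norm_emp_norm by (rule emp_norm_triangle)
  also have "emp_norm n (\<lambda>i. dotp p (x i) \<beta>0 - g i) = cs"
    by (simp add: cs_def emp_norm_def power2_commute)
  finally show ?thesis using D by (simp add: m_def)
qed

text \<open>If T is covered, \<beta>0 itself competes in the restricted least squares and there is
  no excess. Otherwise \<beta>h competes, and its excess over \<beta>0 is at most the penalty
  difference.\<close>

lemma post_lasso_rate:
  assumes sol: "\<beta>h \<in> lasso_solutions n p x y (real n * L)"
    and post: "is_post_ols n p x y (support \<beta>h) \<beta>"
    and c: "c > 1" and L: "c * Smax \<le> L"
    and k0: "0 < k0" "k0 \<le> restricted_eigenvalue n p x s T ((c + 1) / (c - 1))"
    and k: "0 < kappa_tilde n p x T (card (support \<beta>h - T))"
    and mu: "mu n p x T (card (support \<beta>h - T)) \<le> C" "0 \<le> C"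
    and V: "(\<Sum>j\<in>T. (score n x e j)\<^sup>2) \<le> V\<^sup>2" "0 \<le> V"
  shows "emp_norm n (\<lambda>i. dotp p (x i) \<beta> - g i)
      \<le> C * (V + sqrt (real (card (support \<beta>h - T))) * Smax) + 3 * cs
        + (if T \<subseteq> support \<beta>h then 0 else 2 * (L * sqrt (real s) / k0) + cs)"
proof (rule post_ols_rate[OF post _ _ _ k mu V])
  have \<beta>h: "\<beta>h \<in> rvec p" by (rule lasso_solution_rvec[OF sol])
  then show "support \<beta>h \<subseteq> {1..p}" using rvec_finite_support by blast
  have L0: "0 \<le> L" using L c Smax_nonneg by (smt (verit) mult_nonneg_nonneg)
  then show "0 \<le> (if T \<subseteq> support \<beta>h then 0 else 2 * (L * sqrt (real s) / k0) + cs)"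
    using k0 cs_nonneg by simp
  have min: "lsq n p x y \<beta> \<le> lsq n p x y b"
    if "b \<in> rvec p" "support b \<subseteq> support \<beta>h" for b
    using post that by (auto simp: is_post_ols_def is_arg_min_linorder support_def)
  show "lsq n p x y \<beta> \<le> lsq n p x y \<beta>0
      + (if T \<subseteq> support \<beta>h then 0 else 2 * (L * sqrt (real s) / k0) + cs)\<^sup>2"
    using min[OF beta0] min[OF \<beta>h] lasso_l1_bound[OF sol] lasso_lsq_excess[OF sol c L k0]
    by (auto simp: T_def)
qed

text \<open>\<open>\<rho>\<close> is the common scale of score and penalty, later \<sigma>\<surd>(ln
  p / n). The first bound is free of the penalty level because every term of
  \<open>lasso_sparsity\<close> becomes proportional to L.\<close>

lemma post_lasso_bounds:
  fixes \<sigma> \<rho> :: real and s :: nat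
  assumes sol: "\<beta>h \<in> lasso_solutions n p x y (real n * L)"
    and post: "is_post_ols n p x y (support \<beta>h) \<beta>"
    and c: "c > 1" and L: "c * Smax \<le> L"
    and k0: "0 < k0" "k0 \<le> restricted_eigenvalue n p x s T ((c + 1) / (c - 1))"
    and \<sigma>: "0 < \<sigma>" and lower: "\<sigma> / sqrt n \<le> L"
    and upper: "Smax \<le> G * \<rho>" "L \<le> G' * \<rho>"
    and cs: "cs \<le> B * (\<sigma> * sqrt (real s / real n))" "0 \<le> B"
    and k: "0 < kappa_tilde n p x T (card (support \<beta>h - T))"
    and phi: "phi n p x T (card (support \<beta>h - T)) \<le> C\<phi>" "0 \<le> C\<phi>"
    and mu: "mu n p x T (card (support \<beta>h - T)) \<le> C\<mu>" "0 \<le> C\<mu>"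
    and V: "(\<Sum>j\<in>T. (score n x e j)\<^sup>2) \<le> V\<^sup>2" "0 \<le> V"
  shows "sqrt (card (support \<beta>h - T)) \<le> 2 * c * sqrt C\<phi> * (2 / k0 + 3 * B) / (c - 1) * sqrt s"
    and "emp_norm n (\<lambda>i. dotp p (x i) \<beta> - g i)
      \<le> C\<mu> * (V + sqrt (card (support \<beta>h - T)) * (G * \<rho>)) + 3 * cs
        + (if T \<subseteq> support \<beta>h then 0 else 2 * (G' / k0) * (\<rho> * sqrt s) + cs)"
proof -
  let ?m = "real (card (support \<beta>h - T))"
  have "0 < \<sigma> / sqrt n" using \<sigma> n_pos by simp
  then have Lpos: "0 < L" using lower by linarith
  \<comment> \<open>This is where the lower bound on L is used: it makes cs at most a multiple of
    L\<surd>s. The factor 3 of B below collects two cs from \<open>lasso_rate\<close> and one from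
    \<open>lasso_sparsity\<close>.\<close>
  have "B * (\<sigma> * sqrt (real s / real n)) = B * sqrt s * (\<sigma> / sqrt n)" by (simp add: real_sqrt_divide)
  also have "\<dots> \<le> B * sqrt s * L" using cs(2) by (intro mult_left_mono lower) auto
  finally have csL: "cs \<le> B * sqrt s * L" using cs(1) by linarith
  have "(c - 1) * L * sqrt ?m \<le> 2 * c * sqrt C\<phi> * (pnorm (\<lambda>j. \<beta>h j - \<beta>0 j) + cs)"
    by (rule lasso_sparsity[OF sol c L Lpos phi])
  also have "\<dots> \<le> 2 * c * sqrt C\<phi> * ((2 / k0 + 3 * B) * (L * sqrt s))"
    using lasso_rate[OF sol c L k0] csL c phi(2)
    by (intro mult_left_mono) (auto simp: algebra_simps)
  finally have "L * ((c - 1) * sqrt ?m) \<le> L * (2 * c * sqrt C\<phi> * ((2 / k0 + 3 * B) * sqrt s))"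
    by (simp add: mult_ac)
  then have "(c - 1) * sqrt ?m \<le> 2 * c * sqrt C\<phi> * ((2 / k0 + 3 * B) * sqrt s)"
    using Lpos by (simp only: mult_le_cancel_left_pos)
  then show "sqrt ?m \<le> 2 * c * sqrt C\<phi> * (2 / k0 + 3 * B) / (c - 1) * sqrt s"
    using c by (simp add: le_divide_eq mult_ac)
  have "C\<mu> * (V + sqrt ?m * Smax) \<le> C\<mu> * (V + sqrt ?m * (G * \<rho>))"
    using upper(1) mu(2) by (intro mult_left_mono add_left_mono) auto
  moreover have "L * sqrt s / k0 \<le> G' * \<rho> * sqrt s / k0"
    using upper(2) k0 by (intro divide_right_mono mult_right_mono) auto
  moreover have "G' * \<rho> * sqrt s / k0 = (G' / k0) * (\<rho> * sqrt s)" by simp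
  ultimately show "emp_norm n (\<lambda>i. dotp p (x i) \<beta> - g i)
      \<le> C\<mu> * (V + sqrt ?m * (G * \<rho>)) + 3 * cs
        + (if T \<subseteq> support \<beta>h then 0 else 2 * (G' / k0) * (\<rho> * sqrt s) + cs)"
    using post_lasso_rate[OF sol post c L k0 k mu V] by (auto split: if_splits)
qed

end

section \<open>Gaussian scores\<close>

context prob_space
begin

section \<open>Normal tails, small balls and weighted sums\<close>

lemma normal_upper_tail:
  assumes X: "distributed M lborel X (normal_density 0 v)" and v: "0 < v" and t: "0 \<le> t"
  shows "prob {\<omega> \<in> space M. X \<omega> > t} \<le> exp (- t\<^sup>2 / (2 * v\<^sup>2))"
proof -
  \<comment> \<open>For x > t > 0 the square of x is at least the sum of the squares of t and x - t
    (also for t = 0), so the density is dominated by one recentred at t, whose integral is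
    1.\<close>
  have le: "normal_density 0 v x * indicator {t<..} x
      \<le> exp (- t\<^sup>2 / (2 * v\<^sup>2)) * normal_density t v x" for x
  proof (cases "x > t")
    case True
    have "t * t \<le> t * x" using True t by (intro mult_left_mono) auto
    then have "- x\<^sup>2 \<le> - t\<^sup>2 - (x - t)\<^sup>2" by (simp add: power2_eq_square algebra_simps)
    then have "- x\<^sup>2 / (2 * v\<^sup>2) \<le> (- t\<^sup>2 - (x - t)\<^sup>2) / (2 * v\<^sup>2)"
      by (rule divide_right_mono) simp
    then have "exp (- x\<^sup>2 / (2 * v\<^sup>2)) \<le> exp (- t\<^sup>2 / (2 * v\<^sup>2)) * exp (- (x - t)\<^sup>2 / (2 * v\<^sup>2))"
      by (simp add: exp_add[symmetric] diff_divide_distrib)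
    from mult_left_mono[OF this, of "1 / sqrt (2 * pi * v\<^sup>2)"] True show ?thesis
      by (simp add: normal_density_def)
  qed simp
  have "emeasure M (X -` {t<..} \<inter> space M)
      = (\<integral>\<^sup>+x. ennreal (normal_density 0 v x) * indicator {t<..} x \<partial>lborel)"
    by (rule distributed_emeasure[OF X]) simp
  also have "\<dots> \<le> (\<integral>\<^sup>+x. ennreal (exp (- t\<^sup>2 / (2 * v\<^sup>2)) * normal_density t v x) \<partial>lborel)"
  proof (rule nn_integral_mono)
    fix x :: real
    have "ennreal (normal_density 0 v x) * indicator {t<..} x
        = ennreal (normal_density 0 v x * indicator {t<..} x)"
      by (simp add: indicator_def)
    also have "\<dots> \<le> ennreal (exp (- t\<^sup>2 / (2 * v\<^sup>2)) * normal_density t v x)"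
      by (rule ennreal_leI[OF le])
    finally show "ennreal (normal_density 0 v x) * indicator {t<..} x \<le> \<dots>" .
  qed
  also have "\<dots> = ennreal (exp (- t\<^sup>2 / (2 * v\<^sup>2)))"
    using v by (subst nn_integral_eq_integral) auto
  finally have "prob (X -` {t<..} \<inter> space M) \<le> exp (- t\<^sup>2 / (2 * v\<^sup>2))"
    by (simp add: emeasure_eq_measure)
  also have "X -` {t<..} \<inter> space M = {\<omega> \<in> space M. X \<omega> > t}" by auto
  finally show ?thesis .
qed

lemma normal_abs_tail:
  assumes X: "distributed M lborel X (normal_density 0 v)" and v: "0 < v" and t: "0 \<le> t"
  shows "prob {\<omega> \<in> space M. \<bar>X \<omega>\<bar> > t} \<le> 2 * exp (- t\<^sup>2 / (2 * v\<^sup>2))"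
proof -
  have [measurable]: "X \<in> borel_measurable M" using distributed_measurable[OF X] by simp
  have "distributed M lborel (\<lambda>\<omega>. - X \<omega>) (normal_density 0 v)"
    using normal_density_affine[OF X v, of "-1" 0] by simp
  then have neg: "prob {\<omega> \<in> space M. - X \<omega> > t} \<le> exp (- t\<^sup>2 / (2 * v\<^sup>2))"
    by (rule normal_upper_tail) (use v t in auto)
  have "{\<omega> \<in> space M. \<bar>X \<omega>\<bar> > t} = {\<omega> \<in> space M. X \<omega> > t} \<union> {\<omega> \<in> space M. - X \<omega> > t}"
    by auto
  then have "prob {\<omega> \<in> space M. \<bar>X \<omega>\<bar> > t}
      \<le> prob {\<omega> \<in> space M. X \<omega> > t} + prob {\<omega> \<in> space M. - X \<omega> > t}"
    by (simp add: measure_Un_le)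
  with neg normal_upper_tail[OF X v t] show ?thesis by simp
qed

text \<open>The density is at most 1/(2v), since pi is at least 2, and the interval has length 2t.
  This anticoncentration yields the lower bound on the penalty quantile.\<close>

lemma normal_small_ball:
  assumes X: "distributed M lborel X (normal_density 0 v)" and v: "0 < v" and t: "0 \<le> t"
  shows "prob {\<omega> \<in> space M. \<bar>X \<omega>\<bar> \<le> t} \<le> t / v"
proof -
  have "normal_density 0 v x \<le> 1 / (2 * v)" for x
  proof -
    have "2 * v = sqrt ((2 * v)\<^sup>2)" using v by (metis abs_of_pos mult_pos_pos real_sqrt_abs zero_less_numeral)
    also have "\<dots> \<le> sqrt (2 * pi * v\<^sup>2)"
      by (rule real_sqrt_le_mono) (use mult_right_mono[OF pi_ge_two, of "v\<^sup>2"] in \<open>simp add: power_mult_distrib\<close>)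
    finally have "1 / sqrt (2 * pi * v\<^sup>2) \<le> 1 / (2 * v)"
      using v by (intro divide_left_mono) auto
    moreover have "exp (- x\<^sup>2 / (2 * v\<^sup>2)) \<le> 1" by simp
    ultimately have "1 / sqrt (2 * pi * v\<^sup>2) * exp (- x\<^sup>2 / (2 * v\<^sup>2)) \<le> 1 / (2 * v) * 1"
      using v by (intro mult_mono) auto
    then show ?thesis by (simp add: normal_density_def)
  qed
  then have le: "ennreal (normal_density 0 v x) * indicator {-t..t} x
      \<le> ennreal (1 / (2 * v)) * indicator {-t..t} x" for x
    by (intro mult_right_mono ennreal_leI) auto
  have "emeasure M (X -` {-t..t} \<inter> space M)
      = (\<integral>\<^sup>+x. ennreal (normal_density 0 v x) * indicator {-t..t} x \<partial>lborel)"
    by (rule distributed_emeasure[OF X]) simp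
  also have "\<dots> \<le> (\<integral>\<^sup>+x. ennreal (1 / (2 * v)) * indicator {-t..t} x \<partial>lborel)"
    by (intro nn_integral_mono le)
  also have "\<dots> = ennreal (1 / (2 * v) * (2 * t))"
    using t v by (subst nn_integral_cmult_indicator) (simp_all add: ennreal_mult[symmetric] del: ennreal_plus)
  finally have "prob (X -` {-t..t} \<inter> space M) \<le> 1 / (2 * v) * (2 * t)"
    using t v by (simp add: emeasure_eq_measure)
  also have "X -` {-t..t} \<inter> space M = {\<omega> \<in> space M. \<bar>X \<omega>\<bar> \<le> t}" by auto
  finally show ?thesis by simp
qed

text \<open>A zero weight gives a degenerate summand without density, so the sum is first restricted
  to the indices with nonzero weight.\<close>

lemma weighted_sum_indep_normal:
  assumes I: "finite I" and ind: "indep_vars (\<lambda>_. borel) X I" and \<sigma>: "0 < \<sigma>"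
    and X: "\<And>i. i \<in> I \<Longrightarrow> distributed M lborel (X i) (normal_density 0 \<sigma>)"
    and w: "0 < (\<Sum>i\<in>I. (w i)\<^sup>2)"
  shows "distributed M lborel (\<lambda>\<omega>. \<Sum>i\<in>I. w i * X i \<omega>)
           (normal_density 0 (\<sigma> * sqrt (\<Sum>i\<in>I. (w i)\<^sup>2)))"
proof -
  define J where "J = {i \<in> I. w i \<noteq> 0}"
  have J: "finite J" "J \<subseteq> I" using I by (auto simp: J_def)
  have "J \<noteq> {}"
  proof
    assume "J = {}"
    then have "(\<Sum>i\<in>I. (w i)\<^sup>2) = 0" by (intro sum.neutral) (auto simp: J_def)
    with w show False by simp
  qed
  moreover have "indep_vars (\<lambda>_. borel) (\<lambda>i \<omega>. w i * X i \<omega>) J"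
    by (rule indep_vars_compose2[OF indep_vars_subset[OF ind J(2)]]) simp
  moreover have "distributed M lborel (\<lambda>\<omega>. w i * X i \<omega>) (normal_density 0 (\<bar>w i\<bar> * \<sigma>))"
    if "i \<in> J" for i
    using normal_density_affine[OF X \<sigma>, of i "w i" 0] that by (simp add: J_def)
  ultimately have "distributed M lborel (\<lambda>\<omega>. \<Sum>i\<in>J. w i * X i \<omega>)
      (normal_density (\<Sum>i\<in>J. 0) (sqrt (\<Sum>i\<in>J. (\<bar>w i\<bar> * \<sigma>)\<^sup>2)))"
    using \<sigma> J(1) by (intro sum_indep_normal) (auto simp: J_def)
  moreover have "(\<Sum>i\<in>J. w i * X i \<omega>) = (\<Sum>i\<in>I. w i * X i \<omega>)" for \<omega>
    by (rule sum.mono_neutral_left) (use I in \<open>auto simp: J_def\<close>)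
  moreover have "(\<Sum>i\<in>J. (\<bar>w i\<bar> * \<sigma>)\<^sup>2) = (\<Sum>i\<in>I. (\<bar>w i\<bar> * \<sigma>)\<^sup>2)"
    by (rule sum.mono_neutral_left) (use I in \<open>auto simp: J_def\<close>)
  moreover have "sqrt (\<Sum>i\<in>I. (\<bar>w i\<bar> * \<sigma>)\<^sup>2) = \<sigma> * sqrt (\<Sum>i\<in>I. (w i)\<^sup>2)"
    using \<sigma> by (simp add: power_mult_distrib sum_distrib_right[symmetric] real_sqrt_mult)
  ultimately show ?thesis by simp
qed

section \<open>Quantiles as infima\<close>

lemma quantile_le:
  assumes Z: "\<And>\<omega>. \<omega> \<in> space M \<Longrightarrow> 0 \<le> Z \<omega>" and q: "0 < q"
    and t: "q \<le> prob {\<omega> \<in> space M. Z \<omega> \<le> t}"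
  shows "quantile M Z q \<le> t"
  unfolding quantile_def
proof (rule cInf_lower)
  show "bdd_below {t. q \<le> prob {\<omega> \<in> space M. Z \<omega> \<le> t}}"
  \<comment> \<open>A negative level has probability 0 < q, so the infimum is over a set bounded
    below.\<close>
  proof (rule bdd_belowI[of _ 0], rule ccontr)
    fix t assume t: "t \<in> {t. q \<le> prob {\<omega> \<in> space M. Z \<omega> \<le> t}}" "\<not> 0 \<le> t"
    then have "{\<omega> \<in> space M. Z \<omega> \<le> t} = {}" using Z by force
    with t q show False by simp
  qed
qed (use t in simp)

text \<open>The witness \<open>t1\<close> keeps the set nonempty, without which the infimum would be
  an arbitrary value.\<close>

lemma le_quantile:
  assumes "q \<le> prob {\<omega> \<in> space M. Z \<omega> \<le> t1}"
    and "\<And>t. q \<le> prob {\<omega> \<in> space M. Z \<omega> \<le> t} \<Longrightarrow> t0 \<le> t"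
  shows "t0 \<le> quantile M Z q"
  unfolding quantile_def by (rule cInf_greatest) (use assms in auto)

text \<open>Right continuity of the distribution function: the levels
  \<open>quantile M Z q + 1 / Suc k\<close> all have probability at least q, and their events
  decrease to the event at the quantile.\<close>

lemma prob_le_quantile:
  assumes [measurable]: "Z \<in> borel_measurable M"
    and ne: "q \<le> prob {\<omega> \<in> space M. Z \<omega> \<le> t1}"
  shows "q \<le> prob {\<omega> \<in> space M. Z \<omega> \<le> quantile M Z q}"
proof -
  define A where "A = (\<lambda>k. {\<omega> \<in> space M. Z \<omega> \<le> quantile M Z q + 1 / real (Suc k)})"
  have "q \<le> prob (A k)" for k
  proof -
    have "quantile M Z q < quantile M Z q + 1 / real (Suc k)" by simp
    then obtain t where t: "q \<le> prob {\<omega> \<in> space M. Z \<omega> \<le> t}" "t < quantile M Z q + 1 / real (Suc k)"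
      using ne cInf_lessD[of "{t. q \<le> prob {\<omega> \<in> space M. Z \<omega> \<le> t}}"]
      unfolding quantile_def by blast
    moreover have "prob {\<omega> \<in> space M. Z \<omega> \<le> t} \<le> prob (A k)"
      unfolding A_def by (rule finite_measure_mono) (use t(2) in auto)
    ultimately show ?thesis by linarith
  qed
  moreover have "(\<lambda>k. prob (A k)) \<longlonglongrightarrow> prob (\<Inter>k. A k)"
  proof (rule finite_Lim_measure_decseq)
    show "range A \<subseteq> events" by (auto simp: A_def)
    show "decseq A"
      unfolding A_def decseq_def by (auto intro: order_trans add_left_mono simp: frac_le)
  qed
  ultimately have "q \<le> prob (\<Inter>k. A k)" by (intro LIMSEQ_le_const) auto
  also have "(\<Inter>k. A k) = {\<omega> \<in> space M. Z \<omega> \<le> quantile M Z q}"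
  proof (intro equalityI subsetI)
    fix \<omega> assume w: "\<omega> \<in> (\<Inter>k. A k)"
    have "(\<lambda>k. quantile M Z q + 1 / real (Suc k)) \<longlonglongrightarrow> quantile M Z q + 0"
      by (intro tendsto_add tendsto_const LIMSEQ_inverse_real_of_nat[unfolded inverse_eq_divide])
    then have "Z \<omega> \<le> quantile M Z q + 0"
      by (rule LIMSEQ_le_const) (use w in \<open>auto simp: A_def\<close>)
    with w show "\<omega> \<in> {\<omega> \<in> space M. Z \<omega> \<le> quantile M Z q}" by (auto simp: A_def)
  qed (auto simp: A_def intro: order_trans)
  finally show ?thesis .
qed

end

section \<open>Score and penalty quantile under Gaussian noise\<close>

locale gaussian_design = prob_space M for M :: "'a measure" +
  fixes n p :: nat and x :: "nat \<Rightarrow> nat \<Rightarrow> real" and eps :: "nat \<Rightarrow> 'a \<Rightarrow> real" and \<sigma> :: real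
  assumes n_pos: "n \<ge> 1" and p_pos: "p \<ge> 1" and sigma_pos: "\<sigma> > 0"
    and eps_indep: "indep_vars (\<lambda>_. borel) eps {1..n}"
    and eps_normal: "i \<in> {1..n} \<Longrightarrow> distributed M lborel (eps i) (normal_density 0 \<sigma>)"
    and normalized: "j \<in> {1..p} \<Longrightarrow> En n (\<lambda>i. (x i j)\<^sup>2) = 1"
begin

definition S :: "'a \<Rightarrow> nat \<Rightarrow> real" where
  "S \<omega> = score n x (\<lambda>i. eps i \<omega>)"

lemma S_normal:
  assumes "j \<in> {1..p}"
  shows "distributed M lborel (\<lambda>\<omega>. S \<omega> j) (normal_density 0 (2 * \<sigma> / sqrt n))"
proof -
  define w where "w = (\<lambda>i. 2 / real n * x i j)"
  have sq: "(\<Sum>i=1..n. (x i j)\<^sup>2) = real n"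
    using normalized[OF assms] n_pos by (simp add: En_def field_simps)
  have w: "(\<Sum>i=1..n. (w i)\<^sup>2) = 4 / real n"
  proof -
    have "(\<Sum>i=1..n. (w i)\<^sup>2) = (2 / real n)\<^sup>2 * (\<Sum>i=1..n. (x i j)\<^sup>2)"
      unfolding w_def power_mult_distrib sum_distrib_left ..
    with sq show ?thesis using n_pos by (simp add: power2_eq_square)
  qed
  have "distributed M lborel (\<lambda>\<omega>. \<Sum>i=1..n. w i * eps i \<omega>) (normal_density 0 (\<sigma> * sqrt (4 / real n)))"
    using weighted_sum_indep_normal[OF _ eps_indep sigma_pos eps_normal, of w] n_pos w by simp
  moreover have "\<sigma> * sqrt (4 / real n) = 2 * \<sigma> / sqrt n"
    by (simp add: real_sqrt_divide)
  moreover have "(\<Sum>i=1..n. w i * eps i \<omega>) = S \<omega> j" for \<omega>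
    by (simp add: S_def score_def En_def w_def sum_distrib_left mult.assoc)
  ultimately show ?thesis by simp
qed

lemma S_scale_pos: "0 < 2 * \<sigma> / sqrt n"
  using sigma_pos n_pos by simp

lemma S_measurable: "j \<in> {1..p} \<Longrightarrow> (\<lambda>\<omega>. S \<omega> j) \<in> borel_measurable M"
  using distributed_measurable[OF S_normal] by simp

text \<open>The statistic is written exactly as inside \<open>penalty_quantile\<close>, so that the
  two are linked by unfolding alone.\<close>

definition Z :: "'a \<Rightarrow> real" where
  "Z = (\<lambda>\<omega>. real n * linf p (\<lambda>j. score n x (\<lambda>i. eps i \<omega>) j / \<sigma>))"

lemma Z_le_iff: "Z \<omega> \<le> t \<longleftrightarrow> (\<forall>j\<in>{1..p}. \<bar>S \<omega> j\<bar> \<le> \<sigma> * t / n)"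
proof -
  have "Z \<omega> \<le> t \<longleftrightarrow> linf p (\<lambda>j. S \<omega> j / \<sigma>) \<le> t / n"
    using n_pos by (simp add: Z_def S_def field_simps)
  also have "\<dots> \<longleftrightarrow> (\<forall>j\<in>{1..p}. \<bar>S \<omega> j / \<sigma>\<bar> \<le> t / n)"
    unfolding linf_def using p_pos by (subst Max_le_iff) auto
  also have "\<dots> \<longleftrightarrow> (\<forall>j\<in>{1..p}. \<bar>S \<omega> j\<bar> \<le> \<sigma> * t / n)"
    using sigma_pos by (simp add: divide_le_eq mult.commute)
  finally show ?thesis .
qed

lemma Z_nonneg: "0 \<le> Z \<omega>"
proof -
  have "\<bar>S \<omega> 1\<bar> \<le> \<sigma> * Z \<omega> / n" using Z_le_iff[of \<omega> "Z \<omega>"] p_pos by auto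
  then have "0 \<le> \<sigma> * Z \<omega> / n" by linarith
  then show ?thesis using sigma_pos n_pos by (simp add: zero_le_divide_iff zero_le_mult_iff)
qed

lemma Z_measurable [measurable]: "Z \<in> borel_measurable M"
proof (rule borel_measurableI_le)
  fix t
  have [measurable]: "j \<in> {1..p} \<Longrightarrow> (\<lambda>\<omega>. S \<omega> j) \<in> borel_measurable M" for j
    by (rule S_measurable)
  show "{\<omega> \<in> space M. Z \<omega> \<le> t} \<in> events"
    unfolding Z_le_iff by measurable
qed

text \<open>Union bound over the p coordinates. The 8 arises because each score has variance
  4\<sigma>^2/n and is compared with \<sigma>t/n.\<close>

lemma prob_Z_ge:
  assumes "0 \<le> t"
  shows "1 - 2 * real p * exp (- t\<^sup>2 / (8 * real n)) \<le> prob {\<omega> \<in> space M. Z \<omega> \<le> t}"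
proof -
  have [measurable]: "j \<in> {1..p} \<Longrightarrow> (\<lambda>\<omega>. S \<omega> j) \<in> borel_measurable M" for j
    by (rule S_measurable)
  have expo: "- (\<sigma> * t / n)\<^sup>2 / (2 * (2 * \<sigma> / sqrt n)\<^sup>2) = - t\<^sup>2 / (8 * real n)"
    using sigma_pos n_pos by (simp add: power_mult_distrib power_divide power2_eq_square field_simps)
  have "prob {\<omega> \<in> space M. \<not> Z \<omega> \<le> t}
      = prob (\<Union>j\<in>{1..p}. {\<omega> \<in> space M. \<bar>S \<omega> j\<bar> > \<sigma> * t / n})"
    unfolding Z_le_iff by (rule arg_cong[of _ _ prob]) (auto simp: not_le)
  also have "\<dots> \<le> (\<Sum>j\<in>{1..p}. prob {\<omega> \<in> space M. \<bar>S \<omega> j\<bar> > \<sigma> * t / n})"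
    by (rule finite_measure_subadditive_finite) auto
  also have "\<dots> \<le> (\<Sum>j\<in>{1..p}. 2 * exp (- t\<^sup>2 / (8 * real n)))"
  proof (rule sum_mono)
    fix j assume "j \<in> {1..p}"
    then show "prob {\<omega> \<in> space M. \<bar>S \<omega> j\<bar> > \<sigma> * t / n} \<le> 2 * exp (- t\<^sup>2 / (8 * real n))"
      using normal_abs_tail[OF S_normal S_scale_pos, of j "\<sigma> * t / n"] assms sigma_pos
      unfolding expo by simp
  qed
  finally have "prob {\<omega> \<in> space M. \<not> Z \<omega> \<le> t} \<le> 2 * real p * exp (- t\<^sup>2 / (8 * real n))" by simp
  moreover have "prob {\<omega> \<in> space M. \<not> Z \<omega> \<le> t} = 1 - prob {\<omega> \<in> space M. Z \<omega> \<le> t}"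
    by (rule prob_neg) simp
  ultimately show ?thesis by simp
qed

text \<open>A single coordinate already prevents the maximum from being small; p \<ge> 1 supplies
  one.\<close>

lemma prob_Z_le:
  assumes "0 \<le> t"
  shows "prob {\<omega> \<in> space M. Z \<omega> \<le> t} \<le> t / (2 * sqrt n)"
proof -
  have 1: "1 \<in> {1..p}" using p_pos by simp
  have [measurable]: "(\<lambda>\<omega>. S \<omega> 1) \<in> borel_measurable M" by (rule S_measurable[OF 1])
  have "prob {\<omega> \<in> space M. Z \<omega> \<le> t} \<le> prob {\<omega> \<in> space M. \<bar>S \<omega> 1\<bar> \<le> \<sigma> * t / n}"
  proof (rule finite_measure_mono)
    show "{\<omega> \<in> space M. \<bar>S \<omega> 1\<bar> \<le> \<sigma> * t / n} \<in> events" by measurable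
  qed (use 1 in \<open>auto simp: Z_le_iff\<close>)
  also have "\<dots> \<le> (\<sigma> * t / n) / (2 * \<sigma> / sqrt n)"
    by (rule normal_small_ball[OF S_normal[OF 1] S_scale_pos]) (use assms sigma_pos in auto)
  also have "\<dots> = t / (2 * sqrt n)"
    using sigma_pos n_pos by (simp add: field_simps)
  finally show ?thesis .
qed

abbreviation "\<Lambda> \<equiv> penalty_quantile M n p x eps \<sigma>"

lemma penalty_quantile_Z: "\<Lambda> q = quantile M Z q"
  by (simp add: penalty_quantile_def Z_def)

context
  fixes \<alpha> :: real
  assumes \<alpha>: "0 < \<alpha>" "\<alpha> < 1"
begin

text \<open>The threshold is the t at which the union bound equals \<alpha>. Besides bounding the
  quantile it is the witness that its defining set is nonempty.\<close>

lemma prob_Z_le_log: "1 - \<alpha> \<le> prob {\<omega> \<in> space M. Z \<omega> \<le> sqrt (8 * n * ln (2 * p / \<alpha>))}"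
proof -
  have "1 \<le> 2 * p / \<alpha>" using \<alpha> p_pos by (simp add: le_divide_eq)
  then have "0 \<le> 8 * real n * ln (2 * p / \<alpha>)" by simp
  then have "exp (- (sqrt (8 * n * ln (2 * p / \<alpha>)))\<^sup>2 / (8 * real n)) = \<alpha> / (2 * p)"
    using n_pos \<alpha> p_pos by (simp add: exp_minus inverse_eq_divide)
  then have "2 * real p * exp (- (sqrt (8 * n * ln (2 * p / \<alpha>)))\<^sup>2 / (8 * real n)) = \<alpha>"
    using p_pos by simp
  then show ?thesis
    using prob_Z_ge[of "sqrt (8 * n * ln (2 * p / \<alpha>))"] \<open>0 \<le> 8 * real n * ln (2 * p / \<alpha>)\<close> by simp
qed

lemma penalty_quantile_le: "\<Lambda> (1 - \<alpha>) \<le> sqrt (8 * n * ln (2 * p / \<alpha>))"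
  unfolding penalty_quantile_Z
  by (rule quantile_le) (use \<alpha> Z_nonneg prob_Z_le_log in auto)

lemma penalty_quantile_ge: "2 * (1 - \<alpha>) * sqrt n \<le> \<Lambda> (1 - \<alpha>)"
  unfolding penalty_quantile_Z
proof (rule le_quantile[OF prob_Z_le_log])
  fix t assume t: "1 - \<alpha> \<le> prob {\<omega> \<in> space M. Z \<omega> \<le> t}"
  have "0 \<le> t"
  proof (rule ccontr)
    assume "\<not> 0 \<le> t"
    then have "{\<omega> \<in> space M. Z \<omega> \<le> t} = {}" by (auto dest: order_trans[OF Z_nonneg])
    with t \<alpha> show False by simp
  qed
  with t prob_Z_le[of t] have "1 - \<alpha> \<le> t / (2 * sqrt n)" by linarith
  then show "2 * (1 - \<alpha>) * sqrt n \<le> t"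
    using n_pos by (simp add: field_simps)
qed

lemma prob_Z_le_penalty_quantile: "1 - \<alpha> \<le> prob {\<omega> \<in> space M. Z \<omega> \<le> \<Lambda> (1 - \<alpha>)}"
  unfolding penalty_quantile_Z by (rule prob_le_quantile[OF Z_measurable prob_Z_le_log])

end

text \<open>T is not random and each score has second moment 4\<sigma>^2/n, so the expectation of
  the sum is at most s times that, with no logarithm in p.\<close>

lemma score_sq_Markov:
  assumes T: "T \<subseteq> {1..p}" "card T \<le> s" and K: "0 < K"
  shows "prob {\<omega> \<in> space M. (\<Sum>j\<in>T. (S \<omega> j)\<^sup>2) > 4 * K * \<sigma>\<^sup>2 * s / n} \<le> 1 / K"
proof (cases "s = 0")
  case True
  \<comment> \<open>The threshold is 0 here and division by it would be void; the sum is empty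
    instead.\<close>
  with T have "T = {}" using finite_subset[OF T(1)] by auto
  then show ?thesis using True K by simp
next
  case False
  define a where "a = 4 * K * \<sigma>\<^sup>2 * s / n"
  have a: "0 < a" using K sigma_pos n_pos False by (simp add: a_def)
  have S2: "expectation (\<lambda>\<omega>. (S \<omega> j)\<^sup>2) = 4 * \<sigma>\<^sup>2 / n \<and> integrable M (\<lambda>\<omega>. (S \<omega> j)\<^sup>2)" if "j \<in> T" for j
  proof
    have d: "distributed M lborel (\<lambda>\<omega>. S \<omega> j) (normal_density 0 (2 * \<sigma> / sqrt n))"
      by (rule S_normal) (use that T in auto)
    show "expectation (\<lambda>\<omega>. (S \<omega> j)\<^sup>2) = 4 * \<sigma>\<^sup>2 / n"
      using normal_distributed_variance[OF S_scale_pos d]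
      by (simp add: normal_distributed_expectation[OF S_scale_pos d] power_divide power_mult_distrib)
    show "integrable M (\<lambda>\<omega>. (S \<omega> j)\<^sup>2)"
      using distributed_integrable[OF d, of "\<lambda>t. t\<^sup>2"] integrable_normal_moment[OF S_scale_pos, of 0 2]
      by simp
  qed
  then have int: "integrable M (\<lambda>\<omega>. \<Sum>j\<in>T. (S \<omega> j)\<^sup>2)" by auto
  have "prob {\<omega> \<in> space M. (\<Sum>j\<in>T. (S \<omega> j)\<^sup>2) > a} \<le> prob {\<omega> \<in> space M. (\<Sum>j\<in>T. (S \<omega> j)\<^sup>2) \<ge> a}"
    using borel_measurable_integrable[OF int] by (intro finite_measure_mono) auto
  also have "\<dots> \<le> expectation (\<lambda>\<omega>. \<Sum>j\<in>T. (S \<omega> j)\<^sup>2) / a"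
    by (rule integral_Markov_inequality_measure[OF int sets.empty_sets]) (use a in \<open>auto intro!: sum_nonneg\<close>)
  also have "expectation (\<lambda>\<omega>. \<Sum>j\<in>T. (S \<omega> j)\<^sup>2) = card T * (4 * \<sigma>\<^sup>2 / n)"
    using S2 by (subst Bochner_Integration.integral_sum) auto
  also have "card T * (4 * \<sigma>\<^sup>2 / n) / a \<le> s * (4 * \<sigma>\<^sup>2 / n) / a"
    using T a by (intro divide_right_mono mult_right_mono) auto
  also have "s * (4 * \<sigma>\<^sup>2 / n) / a = 1 / K"
    using False sigma_pos n_pos by (simp add: a_def)
  finally show ?thesis using a by (simp add: a_def)
qed

lemma sqrt_mult_div: "sqrt (real n * t) / n = sqrt (t / n)"
proof -
  have "sqrt (real n * t) / n = sqrt n * sqrt t / (sqrt n * sqrt n)"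
    by (simp add: real_sqrt_mult)
  also have "\<dots> = sqrt (t / n)"
    using n_pos by (simp add: real_sqrt_divide field_simps)
  finally show ?thesis .
qed

lemma scaled_penalty_quantile_le:
  assumes \<alpha>: "0 < \<alpha>" "\<alpha> < 1" and p: "1 \<le> ln (real p)" and C: "ln (1 / \<alpha>) \<le> C * ln (real p)"
  shows "\<sigma> * \<Lambda> (1 - \<alpha>) / n \<le> sqrt (8 * (2 + C)) * (\<sigma> * sqrt (ln (real p) / n))"
proof -
  have "ln (2 * p / \<alpha>) = ln 2 + ln (real p) + ln (1 / \<alpha>)"
    using \<alpha> p_pos by (simp add: ln_mult ln_div)
  \<comment> \<open>Since \<open>ln p \<ge> 1\<close>, it absorbs ln 2; this accounts for one of the
    two units and \<open>ln p\<close> itself for the other.\<close>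
  also have "\<dots> \<le> (2 + C) * ln (real p)"
    using ln_2_less_1 p C by (simp add: algebra_simps)
  finally have "8 * real n * ln (2 * p / \<alpha>) \<le> 8 * real n * ((2 + C) * ln (real p))"
    by (intro mult_left_mono) auto
  then have le: "8 * n * ln (2 * p / \<alpha>) \<le> real n * (8 * (2 + C) * ln (real p))"
    by (simp add: algebra_simps)
  have "\<Lambda> (1 - \<alpha>) \<le> sqrt (real n * (8 * (2 + C) * ln (real p)))"
    using penalty_quantile_le[OF \<alpha>] real_sqrt_le_mono[OF le] by linarith
  have "\<Lambda> (1 - \<alpha>) / n \<le> sqrt (8 * (2 + C)) * sqrt (ln (real p) / n)"
  proof -
    have "\<Lambda> (1 - \<alpha>) / n \<le> sqrt (real n * (8 * (2 + C) * ln (real p))) / n"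
      using \<open>\<Lambda> (1 - \<alpha>) \<le> _\<close> by (rule divide_right_mono) simp
    also have "\<dots> = sqrt (8 * (2 + C)) * sqrt (ln (real p) / n)"
      unfolding sqrt_mult_div by (simp only: real_sqrt_mult[symmetric] times_divide_eq_right)
    finally show ?thesis .
  qed
  from mult_left_mono[OF this, of \<sigma>] show ?thesis using sigma_pos by (simp add: mult_ac)
qed

text \<open>The bad event is built before \<omega> is chosen; for each remaining \<omega> the locale
  \<open>fixed_design\<close> is interpreted with the realized noise, so the deterministic bounds
  apply verbatim.\<close>

lemma post_lasso_event:
  fixes fv \<beta>0 :: "nat \<Rightarrow> real" and sighat :: "'a \<Rightarrow> real" and \<beta>hat \<beta>til :: "'a \<Rightarrow> nat \<Rightarrow> real"
    and s :: nat
  assumes beta0: "\<beta>0 \<in> rvec p" and T: "T = support \<beta>0" "card T \<le> s"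
    and cs: "cs = emp_norm n (\<lambda>i. fv i - dotp p (x i) \<beta>0)" "cs\<^sup>2 \<le> Cs * (\<sigma>\<^sup>2 * s / n)" "0 \<le> Cs"
    and \<alpha>: "0 < \<alpha>" "\<alpha> \<le> 1 / 2" and c: "1 < c"
    and l: "0 < l" "l \<le> 1" "c / l \<le> c'" and u: "u / l \<le> Cu"
    and sighat_measurable: "sighat \<in> borel_measurable M"
    and sighat: "1 - \<tau> \<le> prob {\<omega> \<in> space M. l \<le> sighat \<omega> / \<sigma> \<and> sighat \<omega> / \<sigma> \<le> u}"
    and lasso: "\<And>\<omega>. \<omega> \<in> space M \<Longrightarrow>
      \<beta>hat \<omega> \<in> lasso_solutions n p x (\<lambda>i. fv i + eps i \<omega>) (c' * sighat \<omega> * \<Lambda> (1 - \<alpha>))"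
    and post: "\<And>\<omega>. \<omega> \<in> space M \<Longrightarrow>
      is_post_ols n p x (\<lambda>i. fv i + eps i \<omega>) (support (\<beta>hat \<omega>)) (\<beta>til \<omega>)"
    and k0: "0 < k0" "k0 \<le> restricted_eigenvalue n p x s T ((c + 1) / (c - 1))"
    and kt: "AE \<omega> in M. 0 < kappa_tilde n p x T (card (support (\<beta>hat \<omega>) - T))"
    and phi: "AE \<omega> in M. phi n p x T (card (support (\<beta>hat \<omega>) - T)) \<le> C\<phi>" "0 \<le> C\<phi>"
    and mu: "AE \<omega> in M. mu n p x T (card (support (\<beta>hat \<omega>) - T)) \<le> C\<mu>" "0 \<le> C\<mu>"
    and ln_p: "1 \<le> ln (real p)" and C\<alpha>: "ln (1 / \<alpha>) \<le> C\<alpha> * ln (real p)"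
    and G: "G = sqrt (8 * (2 + C\<alpha>))" and K: "0 < K"
    and \<rho>: "\<rho> = \<sigma> * sqrt (ln (real p) / n)"
  shows "\<exists>B\<in>events. prob B \<le> \<alpha> + \<tau> + 1 / K \<and> (\<forall>\<omega>\<in>space M - B.
    sqrt (card (support (\<beta>hat \<omega>) - T)) \<le> 2 * c * sqrt C\<phi> * (2 / k0 + 3 * sqrt Cs) / (c - 1) * sqrt s \<and>
    emp_norm n (\<lambda>i. dotp p (x i) (\<beta>til \<omega>) - fv i)
      \<le> C\<mu> * (2 * sqrt K * (\<sigma> * sqrt (real s / n)) + sqrt (card (support (\<beta>hat \<omega>) - T)) * (G * \<rho>)) + 3 * cs
        + (if T \<subseteq> support (\<beta>hat \<omega>) then 0 else 2 * (c' * Cu * G / k0) * (\<rho> * sqrt s) + cs))"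
proof -
  have \<alpha>1: "\<alpha> < 1" using \<alpha> by simp
  let ?L = "\<Lambda> (1 - \<alpha>)"
  let ?m = "\<lambda>\<omega>. card (support (\<beta>hat \<omega>) - T)"
  let ?good = "\<lambda>\<omega>. l \<le> sighat \<omega> / \<sigma> \<and> sighat \<omega> / \<sigma> \<le> u"
  note [measurable] = sighat_measurable
  have Tp: "T \<subseteq> {1..p}" using rvec_finite_support[OF beta0] T by simp
  have [measurable]: "j \<in> T \<Longrightarrow> (\<lambda>\<omega>. S \<omega> j) \<in> borel_measurable M" for j
    by (rule S_measurable) (use Tp in auto)
  from kt phi(1) mu(1) have "AE \<omega> in M. 0 < kappa_tilde n p x T (?m \<omega>) \<and> phi n p x T (?m \<omega>) \<le> C\<phi>
      \<and> mu n p x T (?m \<omega>) \<le> C\<mu>" by eventually_elim simp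
  \<comment> \<open>The almost sure eigenvalue conditions are replaced by a measurable null set
    outside which they hold everywhere.\<close>
  then obtain N where N: "{\<omega> \<in> space M. \<not> (0 < kappa_tilde n p x T (?m \<omega>) \<and> phi n p x T (?m \<omega>) \<le> C\<phi>
      \<and> mu n p x T (?m \<omega>) \<le> C\<mu>)} \<subseteq> N" "emeasure M N = 0" "N \<in> events" by (rule AE_E)
  define B1 where "B1 = {\<omega> \<in> space M. \<not> ?good \<omega>}"
  define B2 where "B2 = {\<omega> \<in> space M. \<not> Z \<omega> \<le> ?L}"
  define B3 where "B3 = {\<omega> \<in> space M. (\<Sum>j\<in>T. (S \<omega> j)\<^sup>2) > 4 * K * \<sigma>\<^sup>2 * s / n}"
  define B where "B = N \<union> B1 \<union> B2 \<union> B3"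
  have ev: "B1 \<in> events" "B2 \<in> events" "B3 \<in> events" unfolding B1_def B2_def B3_def by measurable
  have "prob B1 = 1 - prob {\<omega> \<in> space M. ?good \<omega>}"
    unfolding B1_def by (rule prob_neg) measurable
  then have P1: "prob B1 \<le> \<tau>" using sighat by linarith
  have "prob B2 = 1 - prob {\<omega> \<in> space M. Z \<omega> \<le> ?L}"
    unfolding B2_def by (rule prob_neg) measurable
  then have P2: "prob B2 \<le> \<alpha>" using prob_Z_le_penalty_quantile[OF \<alpha>(1) \<alpha>1] by linarith
  have P3: "prob B3 \<le> 1 / K" unfolding B3_def by (rule score_sq_Markov[OF Tp T(2) K])
  have "prob B \<le> prob (N \<union> B1 \<union> B2) + prob B3"
    unfolding B_def using N(3) ev by (intro measure_Un_le) auto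
  also have "prob (N \<union> B1 \<union> B2) \<le> prob (N \<union> B1) + prob B2"
    using N(3) ev by (intro measure_Un_le) auto
  also have "prob (N \<union> B1) \<le> prob N + prob B1"
    using N(3) ev by (intro measure_Un_le) auto
  also have "prob N = 0" using N(2) by (simp add: measure_def)
  finally have PB: "prob B \<le> \<alpha> + \<tau> + 1 / K" using P1 P2 P3 by linarith
  have "sqrt (card (support (\<beta>hat \<omega>) - T)) \<le> 2 * c * sqrt C\<phi> * (2 / k0 + 3 * sqrt Cs) / (c - 1) * sqrt s \<and>
    emp_norm n (\<lambda>i. dotp p (x i) (\<beta>til \<omega>) - fv i)
      \<le> C\<mu> * (2 * sqrt K * (\<sigma> * sqrt (real s / n)) + sqrt (card (support (\<beta>hat \<omega>) - T)) * (G * \<rho>)) + 3 * cs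
        + (if T \<subseteq> support (\<beta>hat \<omega>) then 0 else 2 * (c' * Cu * G / k0) * (\<rho> * sqrt s) + cs)"
    if \<omega>: "\<omega> \<in> space M - B" for \<omega>
  proof -
    have w: "\<omega> \<in> space M" using \<omega> by simp
    have kpm: "0 < kappa_tilde n p x T (?m \<omega>)" "phi n p x T (?m \<omega>) \<le> C\<phi>" "mu n p x T (?m \<omega>) \<le> C\<mu>"
      using \<omega> N(1) by (auto simp: B_def)
    have good: "l * \<sigma> \<le> sighat \<omega>" "sighat \<omega> \<le> u * \<sigma>"
      using \<omega> sigma_pos by (auto simp: B_def B1_def field_simps)
    have ZL: "Z \<omega> \<le> ?L" using \<omega> by (auto simp: B_def B2_def)
    have V: "(\<Sum>j\<in>T. (S \<omega> j)\<^sup>2) \<le> 4 * K * \<sigma>\<^sup>2 * s / n" using \<omega> by (auto simp: B_def B3_def not_less)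
    define Sm where "Sm = \<sigma> * ?L / n"
    \<comment> \<open>\<open>\<alpha> \<le> 1 / 2\<close> makes the factor
      \<open>2 * (1 - \<alpha>)\<close> of the quantile bound at least 1.\<close>
    have "sqrt n = 2 * (1 / 2) * sqrt n" by simp
    also have "\<dots> \<le> 2 * (1 - \<alpha>) * sqrt n" using \<alpha> by (intro mult_right_mono) auto
    also have "\<dots> \<le> ?L" by (rule penalty_quantile_ge[OF \<alpha>(1) \<alpha>1])
    finally have Lge: "sqrt n \<le> ?L" .
    have Lpos: "0 \<le> ?L" using Lge by (rule order_trans[rotated]) simp
    have "\<sigma> * sqrt n / n \<le> Sm"
      unfolding Sm_def using Lge sigma_pos by (intro divide_right_mono mult_left_mono) auto
    moreover have "\<sigma> * sqrt n / n = \<sigma> / sqrt n"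
      using sqrt_divide_self_eq[of "real n"] by (simp add: divide_inverse mult.assoc)
    ultimately have Sm_ge: "\<sigma> / sqrt n \<le> Sm" by simp
    have Sm0: "0 \<le> Sm" using Lpos sigma_pos by (simp add: Sm_def)
    interpret fd: fixed_design n p x fv "\<lambda>i. eps i \<omega>" \<beta>0 T cs Sm
    proof
      show "\<bar>score n x (\<lambda>i. eps i \<omega>) j\<bar> \<le> Sm" if "j \<in> {1..p}" for j
        using ZL that unfolding Z_le_iff S_def Sm_def by blast
    qed (use n_pos normalized beta0 T cs Sm0 in auto)
    define L where "L = c' * sighat \<omega> * ?L / n"
    have "0 < c / l" using c l by simp
    then have c'0: "0 < c'" using l(3) by linarith
    \<comment> \<open>Splitting c as c/l times l pairs c/l with c' and l\<sigma> with
      \<open>sighat\<close>.\<close>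
    have "c * Sm = c / l * (l * \<sigma>) * ?L / n" using l by (simp add: Sm_def)
    also have "\<dots> \<le> c' * sighat \<omega> * ?L / n"
      using l c good(1) Lpos sigma_pos c'0
      by (intro divide_right_mono mult_right_mono mult_mono) auto
    finally have cL: "c * Sm \<le> L" by (simp add: L_def)
    have "1 * Sm \<le> c * Sm" using c Sm0 by (intro mult_right_mono) auto
    then have lower: "\<sigma> / sqrt n \<le> L" using cL Sm_ge by linarith
    have SmG: "Sm \<le> G * \<rho>"
      unfolding Sm_def G \<rho> by (rule scaled_penalty_quantile_le[OF \<alpha>(1) \<alpha>1 ln_p C\<alpha>])
    have Cu0: "u \<le> Cu * l" using u l by (simp add: divide_le_eq)
    have u0: "0 < u"
    proof -
      have "0 < l * \<sigma>" using l sigma_pos by simp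
      also have "\<dots> \<le> u * \<sigma>" using good by linarith
      finally show ?thesis using sigma_pos by (simp add: zero_less_mult_iff)
    qed
    have Cupos: "0 \<le> Cu" using u divide_pos_pos[OF u0 l(1)] by linarith
    \<comment> \<open>As l \<le> 1, the bound on u/l also bounds u.\<close>
    have "u \<le> Cu" using Cu0 mult_left_mono[OF l(2) Cupos] by simp
    then have "sighat \<omega> \<le> Cu * \<sigma>" using good(2) sigma_pos mult_right_mono[of u Cu \<sigma>] by linarith
    then have "L \<le> c' * (Cu * \<sigma>) * ?L / n"
      unfolding L_def using c'0 Lpos by (intro divide_right_mono mult_right_mono mult_left_mono) auto
    also have "\<dots> = c' * Cu * Sm" by (simp add: Sm_def)
    also have "\<dots> \<le> c' * Cu * (G * \<rho>)" using c'0 Cupos by (intro mult_left_mono SmG) auto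
    finally have upper: "L \<le> c' * Cu * G * \<rho>" by (simp add: mult_ac)
    have "sqrt (cs\<^sup>2) \<le> sqrt (Cs * (\<sigma>\<^sup>2 * s / n))" by (rule real_sqrt_le_mono[OF cs(2)])
    then have csB: "cs \<le> sqrt Cs * (\<sigma> * sqrt (real s / n))"
      using fd.cs_nonneg sigma_pos by (simp add: real_sqrt_mult real_sqrt_divide)
    have Vsq: "(2 * sqrt K * (\<sigma> * sqrt (real s / n)))\<^sup>2 = 4 * K * \<sigma>\<^sup>2 * s / n"
      using K by (simp add: power_mult_distrib)
    have V': "(\<Sum>j\<in>T. (score n x (\<lambda>i. eps i \<omega>) j)\<^sup>2) \<le> (2 * sqrt K * (\<sigma> * sqrt (real s / n)))\<^sup>2"
      using V unfolding Vsq S_def .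
    have sol: "\<beta>hat \<omega> \<in> lasso_solutions n p x (\<lambda>i. fv i + eps i \<omega>) (real n * L)"
      using lasso[OF w] n_pos by (simp add: L_def)
    note b = fd.post_lasso_bounds[OF sol post[OF w] c cL k0 sigma_pos lower SmG upper csB _ kpm(1,2) phi(2) kpm(3) mu(2) V']
    show ?thesis using b cs(3) K sigma_pos by auto
  qed
  then show ?thesis using PB N(3) ev by (intro bexI[of _ B]) (auto simp: B_def)
qed

end

section \<open>Stochastic orders\<close>

text \<open>The measurable set \<open>B\<close> covers the event in the definition of
  \<open>bigO_P\<close>, so the bound follows by monotonicity from inequalities that hold pointwise
  off \<open>B\<close>.\<close>

lemma bigO_P_I:
  assumes fin: "\<forall>\<^sub>F n in sequentially. finite_measure (M n)"
    and ex: "\<And>\<eta>. 0 < \<eta> \<Longrightarrow> \<exists>K>0. \<forall>\<^sub>F n in sequentially. \<exists>B\<in>sets (M n). measure (M n) B \<le> \<eta> \<and>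
      (\<forall>\<omega>\<in>space (M n) - B. \<bar>a n \<omega>\<bar> \<le> K * \<bar>b n\<bar>)"
  shows "bigO_P M a b"
  unfolding bigO_P_def
proof (intro allI impI)
  fix \<eta> :: real assume "\<eta> > 0"
  then obtain K where K: "K > 0" and ev: "\<forall>\<^sub>F n in sequentially. \<exists>B\<in>sets (M n). measure (M n) B \<le> \<eta> \<and>
      (\<forall>\<omega>\<in>space (M n) - B. \<bar>a n \<omega>\<bar> \<le> K * \<bar>b n\<bar>)"
    using ex by blast
  from ev fin have "\<forall>\<^sub>F n in sequentially. measure (M n) {\<omega> \<in> space (M n). \<bar>a n \<omega>\<bar> > K * \<bar>b n\<bar>} \<le> \<eta>"
  proof eventually_elim
    case (elim n)
    then obtain B where B: "B \<in> sets (M n)" "measure (M n) B \<le> \<eta>"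
      "\<forall>\<omega>\<in>space (M n) - B. \<bar>a n \<omega>\<bar> \<le> K * \<bar>b n\<bar>" by auto
    then have "{\<omega> \<in> space (M n). \<bar>a n \<omega>\<bar> > K * \<bar>b n\<bar>} \<subseteq> B" by force
    then have "measure (M n) {\<omega> \<in> space (M n). \<bar>a n \<omega>\<bar> > K * \<bar>b n\<bar>} \<le> measure (M n) B"
      using elim(2) B(1) by (intro finite_measure.finite_measure_mono)
    with B(2) show ?case by linarith
  qed
  with K show "\<exists>K>0. \<forall>\<^sub>F n in sequentially.
      measure (M n) {\<omega> \<in> space (M n). \<bar>a n \<omega>\<bar> > K * \<bar>b n\<bar>} \<le> \<eta>" by auto
qed

text \<open>The deterministic rate comes from the Ky Fan distance between \<open>a / b\<close> and zero.\<close>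

lemma smallo_P_deterministic_rate:
  fixes a :: "nat \<Rightarrow> 'a \<Rightarrow> real" and b :: "nat \<Rightarrow> real"
  assumes pr: "\<And>n. n \<ge> 1 \<Longrightarrow> prob_space (M n)"
    and meas: "\<And>n. n \<ge> 1 \<Longrightarrow> a n \<in> borel_measurable (M n)"
    and small: "smallo_P M a b" and b: "\<And>n. 0 \<le> b n"
  obtains r where "\<And>n. 0 \<le> r n" "r \<in> o(b)"
    "(\<lambda>n. measure (M n) {\<omega> \<in> space (M n). a n \<omega> > r n}) \<longlonglongrightarrow> 0"
proof -
  define Q where "Q = (\<lambda>n \<eta>. measure (M n) {\<omega> \<in> space (M n). \<bar>a n \<omega>\<bar> > \<eta> * \<bar>b n\<bar>})"
  define E where "E = (\<lambda>n. {\<eta>. 0 < \<eta> \<and> Q n \<eta> \<le> \<eta>})"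
  \<comment> \<open>The infimum may fail to belong to \<open>E n\<close>; the vanishing summand puts
    \<open>\<theta> n\<close> above some element of it, and \<open>Q n\<close> is
    decreasing.\<close>
  define \<theta> where "\<theta> = (\<lambda>n. Inf (E n) + 1 / real (Suc n))"
  have bdd: "bdd_below (E n)" for n by (rule bdd_belowI[of _ 0]) (simp add: E_def)
  have one: "1 \<in> E n" if "n \<ge> 1" for n
    using prob_space.prob_le_1[OF pr[OF that]] by (simp add: E_def Q_def)
  have inf0: "0 \<le> Inf (E n)" if "n \<ge> 1" for n
  proof (rule cInf_greatest)
    show "E n \<noteq> {}" using one[OF that] by blast
  qed (simp add: E_def)
  have \<theta>0: "0 \<le> \<theta> n" if "n \<ge> 1" for n using inf0[OF that] by (simp add: \<theta>_def)
  have "(\<lambda>n. Inf (E n)) \<longlonglongrightarrow> 0"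
  proof (rule order_tendstoI)
    fix e :: real assume "e < 0"
    then show "\<forall>\<^sub>F n in sequentially. e < Inf (E n)"
      using inf0 by (intro eventually_sequentiallyI[of 1]) force
  next
    fix e :: real assume e: "0 < e"
    have "(\<lambda>n. Q n (e / 2)) \<longlonglongrightarrow> 0"
      using small half_gt_zero[OF e] unfolding smallo_P_def Q_def by blast
    then have "\<forall>\<^sub>F n in sequentially. Q n (e / 2) < e / 2"
      using e by (intro order_tendstoD) auto
    then show "\<forall>\<^sub>F n in sequentially. Inf (E n) < e"
    proof eventually_elim
      case (elim n)
      then have "Inf (E n) \<le> e / 2" using e by (intro cInf_lower bdd) (simp add: E_def)
      then show ?case using e by linarith
    qed
  qed
  then have "(\<lambda>n. Inf (E n) + inverse (real (Suc n))) \<longlonglongrightarrow> 0 + 0"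
    by (intro tendsto_add LIMSEQ_inverse_real_of_nat)
  then have \<theta>: "\<theta> \<longlonglongrightarrow> 0" by (simp add: \<theta>_def inverse_eq_divide)
  have Q\<theta>: "Q n (\<theta> n) \<le> \<theta> n" if n: "n \<ge> 1" for n
  proof -
    interpret prob_space "M n" by (rule pr[OF n])
    have [measurable]: "a n \<in> borel_measurable (M n)" by (rule meas[OF n])
    have "Inf (E n) < \<theta> n" by (simp add: \<theta>_def)
    then obtain \<eta> where \<eta>: "\<eta> \<in> E n" "\<eta> < \<theta> n" using one[OF n] cInf_lessD[of "E n"] by blast
    have "\<eta> * \<bar>b n\<bar> \<le> \<theta> n * \<bar>b n\<bar>" using \<eta>(2) by (intro mult_right_mono) auto
    then have "Q n (\<theta> n) \<le> Q n \<eta>"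
      unfolding Q_def by (intro finite_measure_mono) auto
    with \<eta> show ?thesis by (simp add: E_def)
  qed
  \<comment> \<open>The absolute value secures \<open>0 \<le> r n\<close> also at n = 0, where
    nothing is known about \<open>M n\<close> and hence about \<open>\<theta> n\<close>.\<close>
  define r where "r = (\<lambda>n. \<bar>\<theta> n\<bar> * b n)"
  show ?thesis
  proof
    show "0 \<le> r n" for n using b by (simp add: r_def)
    show "r \<in> o(b)"
    proof (rule landau_o.smallI)
      fix e :: real assume "e > 0"
      then have "\<forall>\<^sub>F n in sequentially. \<bar>\<theta> n\<bar> < e"
        using \<theta> by (intro order_tendstoD[OF tendsto_rabs_zero]) auto
      then show "\<forall>\<^sub>F n in sequentially. norm (r n) \<le> e * norm (b n)"
        by eventually_elim (use b in \<open>auto simp: r_def abs_mult intro: mult_right_mono\<close>)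
    qed
    show "(\<lambda>n. measure (M n) {\<omega> \<in> space (M n). a n \<omega> > r n}) \<longlonglongrightarrow> 0"
    proof (rule tendsto_sandwich[OF _ _ tendsto_const \<theta>])
      show "\<forall>\<^sub>F n in sequentially. measure (M n) {\<omega> \<in> space (M n). a n \<omega> > r n} \<le> \<theta> n"
      proof (rule eventually_sequentiallyI[of 1])
        fix n :: nat assume n: "1 \<le> n"
        interpret prob_space "M n" by (rule pr[OF n])
        have [measurable]: "a n \<in> borel_measurable (M n)" by (rule meas[OF n])
        have "measure (M n) {\<omega> \<in> space (M n). a n \<omega> > r n} \<le> Q n (\<theta> n)"
          unfolding Q_def r_def using \<theta>0[OF n] b[of n] by (intro finite_measure_mono) auto
        with Q\<theta>[OF n] show "measure (M n) {\<omega> \<in> space (M n). a n \<omega> > r n} \<le> \<theta> n" by linarith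
      qed
    qed simp
  qed
qed

lemma wpa1_complement:
  assumes pr: "\<And>n. n \<ge> 1 \<Longrightarrow> prob_space (M n)"
    and meas: "\<And>n. n \<ge> 1 \<Longrightarrow> {\<omega> \<in> space (M n). E n \<omega>} \<in> sets (M n)"
    and "wpa1 M E"
  shows "(\<lambda>n. measure (M n) {\<omega> \<in> space (M n). \<not> E n \<omega>}) \<longlonglongrightarrow> 0"
proof -
  have "(\<lambda>n. 1 - measure (M n) {\<omega> \<in> space (M n). E n \<omega>}) \<longlonglongrightarrow> 1 - 1"
    using assms(3) by (intro tendsto_diff) (simp_all add: wpa1_def)
  moreover have "\<forall>\<^sub>F n in sequentially. 1 - measure (M n) {\<omega> \<in> space (M n). E n \<omega>}
      = measure (M n) {\<omega> \<in> space (M n). \<not> E n \<omega>}"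
    by (rule eventually_sequentiallyI[of 1]) (simp add: prob_space.prob_neg[OF pr meas])
  ultimately have "(\<lambda>n. measure (M n) {\<omega> \<in> space (M n). \<not> E n \<omega>}) \<longlonglongrightarrow> 1 - 1"
    by (rule Lim_transform_eventually)
  then show ?thesis by simp
qed

text \<open>In the application \<open>a\<close> is the rate of the noise on the true support, \<open>\<rho>\<close> the rate of the
  maximal score, \<open>b\<close> the approximation error and \<open>Cov\<close> the event \<open>T \<subseteq> That\<close>.\<close>

locale stochastic_bound =
  fixes M :: "nat \<Rightarrow> 'a measure" and err m :: "nat \<Rightarrow> 'a \<Rightarrow> real" and Cov :: "nat \<Rightarrow> 'a \<Rightarrow> bool"
    and a \<rho> b s \<delta> :: "nat \<Rightarrow> real" and C :: real
  assumes pr: "\<And>n. n \<ge> 1 \<Longrightarrow> prob_space (M n)"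
    and m_meas: "\<And>n. n \<ge> 1 \<Longrightarrow> m n \<in> borel_measurable (M n)"
    and Cov_meas: "\<And>n. n \<ge> 1 \<Longrightarrow> {\<omega> \<in> space (M n). Cov n \<omega>} \<in> sets (M n)"
    and err_nonneg: "\<And>n \<omega>. 0 \<le> err n \<omega>"
    and nonneg: "\<And>n. n \<ge> 1 \<Longrightarrow> 0 \<le> a n \<and> 0 \<le> \<rho> n \<and> 0 \<le> b n" "\<And>n. 0 \<le> s n"
    and a_le: "\<forall>\<^sub>F n in sequentially. a n \<le> \<rho> n * sqrt (s n)"
    and \<delta>: "\<delta> \<longlonglongrightarrow> 0" and C: "0 < C"
    and bound: "\<And>K. 0 < K \<Longrightarrow> \<forall>\<^sub>F n in sequentially. \<exists>B\<in>sets (M n). measure (M n) B \<le> \<delta> n + 1 / K \<and>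
        (\<forall>\<omega>\<in>space (M n) - B. sqrt (m n \<omega>) \<le> C * sqrt (s n) \<and>
          err n \<omega> \<le> C * (sqrt K * a n + sqrt (m n \<omega>) * \<rho> n + b n)
            + (if Cov n \<omega> then 0 else C * (\<rho> n * sqrt (s n))))"
begin

lemma eventually_finite_measure: "\<forall>\<^sub>F n in sequentially. finite_measure (M n)"
  by (rule eventually_sequentiallyI[of 1]) (use pr prob_space.axioms(1) in blast)

lemma eventually_small:
  assumes "X \<longlonglongrightarrow> (0::real)" "0 < \<eta>"
  shows "\<forall>\<^sub>F n in sequentially. X n \<le> \<eta>"
  using order_tendstoD(2)[OF assms] by eventually_elim simp

lemma general_rate: "bigO_P M err (\<lambda>n. \<rho> n * sqrt (s n) + b n)"
proof (rule bigO_P_I[OF eventually_finite_measure])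
  fix \<eta> :: real assume \<eta>: "0 < \<eta>"
  \<comment> \<open>Half of the tolerance goes to \<open>1 / K\<close>, half to
    \<open>\<delta> n\<close>.\<close>
  define K where "K = 2 / \<eta>"
  have K: "0 < K" using \<eta> by (simp add: K_def)
  define C' where "C' = C * (sqrt K + C + 2)"
  have "C' > 0" using C K by (simp add: C'_def add_pos_pos)
  moreover have "\<forall>\<^sub>F n in sequentially. \<exists>B\<in>sets (M n). measure (M n) B \<le> \<eta> \<and>
      (\<forall>\<omega>\<in>space (M n) - B. \<bar>err n \<omega>\<bar> \<le> C' * \<bar>\<rho> n * sqrt (s n) + b n\<bar>)"
    using bound[OF K] eventually_small[OF \<delta> half_gt_zero[OF \<eta>]] a_le eventually_ge_at_top[of 1]
  proof eventually_elim
    case (elim n)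
    then obtain B where B: "B \<in> sets (M n)" "measure (M n) B \<le> \<delta> n + 1 / K"
      and bd: "\<And>\<omega>. \<omega> \<in> space (M n) - B \<Longrightarrow> sqrt (m n \<omega>) \<le> C * sqrt (s n) \<and>
          err n \<omega> \<le> C * (sqrt K * a n + sqrt (m n \<omega>) * \<rho> n + b n)
            + (if Cov n \<omega> then 0 else C * (\<rho> n * sqrt (s n)))" by auto
    have nn: "0 \<le> \<rho> n" "0 \<le> b n" "0 \<le> s n" using nonneg elim(4) by auto
    define R where "R = \<rho> n * sqrt (s n)"
    have R: "0 \<le> R" using nn by (simp add: R_def)
    have "\<bar>err n \<omega>\<bar> \<le> C' * \<bar>R + b n\<bar>" if \<omega>: "\<omega> \<in> space (M n) - B" for \<omega>
    proof -
      have "sqrt (m n \<omega>) * \<rho> n \<le> C * sqrt (s n) * \<rho> n"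
        using bd[OF \<omega>] nn by (intro mult_right_mono) auto
      then have 1: "sqrt (m n \<omega>) * \<rho> n \<le> C * R" by (simp add: R_def mult_ac)
      have 2: "sqrt K * a n \<le> sqrt K * R" using elim(3) K by (intro mult_left_mono) (auto simp: R_def)
      have 3: "(if Cov n \<omega> then 0 else C * (\<rho> n * sqrt (s n))) \<le> C * R" using R C by (simp add: R_def)
      have "C * (sqrt K * a n + sqrt (m n \<omega>) * \<rho> n + b n) \<le> C * (sqrt K * R + C * R + b n)"
        using 1 2 C by (intro mult_left_mono) auto
      then have "err n \<omega> \<le> C * (sqrt K * R + C * R + b n) + C * R" using bd[OF \<omega>] 3 by linarith
      also have "\<dots> \<le> C' * (R + b n)"
      proof -
        have "0 \<le> C * (R + (sqrt K + C + 1) * b n)" using C K R nn by simp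
        then show ?thesis by (simp add: C'_def algebra_simps)
      qed
      finally show ?thesis using R nn err_nonneg[of n \<omega>] by simp
    qed
    moreover have "measure (M n) B \<le> \<eta>" using B(2) elim(2) by (simp add: K_def)
    ultimately show ?case using B(1) by (auto simp: R_def)
  qed
  ultimately show "\<exists>K>0. \<forall>\<^sub>F n in sequentially. \<exists>B\<in>sets (M n). measure (M n) B \<le> \<eta> \<and>
      (\<forall>\<omega>\<in>space (M n) - B. \<bar>err n \<omega>\<bar> \<le> K * \<bar>\<rho> n * sqrt (s n) + b n\<bar>)" by blast
qed

text \<open>Here r takes the place of s in the bound for m, and the uncovered term disappears off an
  event of vanishing probability. The choice r = 0 is allowed and gives exact recovery.\<close>

lemma covering_rate:
  assumes m: "(\<lambda>n. measure (M n) {\<omega> \<in> space (M n). m n \<omega> > r n}) \<longlonglongrightarrow> 0" and r: "\<And>n. 0 \<le> r n"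
    and cov: "wpa1 M Cov"
  shows "bigO_P M err (\<lambda>n. \<rho> n * sqrt (r n) + a n + b n)"
proof (rule bigO_P_I[OF eventually_finite_measure])
  fix \<eta> :: real assume \<eta>: "0 < \<eta>"
  have cov0: "(\<lambda>n. measure (M n) {\<omega> \<in> space (M n). \<not> Cov n \<omega>}) \<longlonglongrightarrow> 0"
    by (rule wpa1_complement[OF pr Cov_meas cov])
  from \<eta> have \<eta>4: "0 < \<eta> / 4" by simp
  \<comment> \<open>Four quarters: \<open>\<delta> n\<close>, \<open>1 / K\<close>, the event that m
    exceeds r, and the failure of \<open>Cov\<close>.\<close>
  define K where "K = 4 / \<eta>"
  have K: "0 < K" using \<eta> by (simp add: K_def)
  define C' where "C' = C * (sqrt K + 1)"
  have "C' > 0" using C K by (simp add: C'_def add_pos_pos)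
  moreover have "\<forall>\<^sub>F n in sequentially. \<exists>B\<in>sets (M n). measure (M n) B \<le> \<eta> \<and>
      (\<forall>\<omega>\<in>space (M n) - B. \<bar>err n \<omega>\<bar> \<le> C' * \<bar>\<rho> n * sqrt (r n) + a n + b n\<bar>)"
    using bound[OF K] eventually_small[OF \<delta> \<eta>4] eventually_small[OF m \<eta>4]
      eventually_small[OF cov0 \<eta>4] eventually_ge_at_top[of 1]
  proof eventually_elim
    case (elim n)
    then obtain B where B: "B \<in> sets (M n)" "measure (M n) B \<le> \<delta> n + 1 / K"
      and bd: "\<And>\<omega>. \<omega> \<in> space (M n) - B \<Longrightarrow>
          err n \<omega> \<le> C * (sqrt K * a n + sqrt (m n \<omega>) * \<rho> n + b n)
            + (if Cov n \<omega> then 0 else C * (\<rho> n * sqrt (s n)))" by auto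
    have nn: "0 \<le> \<rho> n" "0 \<le> a n" "0 \<le> b n" using nonneg elim(5) by auto
    interpret prob_space "M n" by (rule pr[OF elim(5)])
    define B1 where "B1 = {\<omega> \<in> space (M n). m n \<omega> > r n}"
    define B2 where "B2 = {\<omega> \<in> space (M n). \<not> Cov n \<omega>}"
    have B12: "B1 \<in> events" "B2 \<in> events"
      using m_meas[OF elim(5)] Cov_meas[OF elim(5)] unfolding B1_def B2_def by measurable
    have "prob (B \<union> B1 \<union> B2) \<le> prob B + prob B1 + prob B2"
      using B(1) B12 measure_Un_le[of "B \<union> B1" "M n" B2] measure_Un_le[of B "M n" B1] by auto
    also have "\<dots> \<le> \<eta>"
      using B(2) elim(2-4) \<eta> unfolding B1_def B2_def by (simp add: K_def)
    finally have "prob (B \<union> B1 \<union> B2) \<le> \<eta>" .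
    moreover have "\<bar>err n \<omega>\<bar> \<le> C' * \<bar>\<rho> n * sqrt (r n) + a n + b n\<bar>"
      if \<omega>: "\<omega> \<in> space (M n) - (B \<union> B1 \<union> B2)" for \<omega>
    proof -
      have c: "Cov n \<omega>" and mr: "m n \<omega> \<le> r n" using \<omega> by (auto simp: B1_def B2_def)
      define R where "R = \<rho> n * sqrt (r n)"
      have R: "0 \<le> R" using nn r by (simp add: R_def)
      have "sqrt (m n \<omega>) * \<rho> n \<le> R"
        using nn mr unfolding R_def by (subst mult.commute) (intro mult_left_mono, auto)
      then have "C * (sqrt K * a n + sqrt (m n \<omega>) * \<rho> n + b n) \<le> C * (sqrt K * a n + R + b n)"
        using C by (intro mult_left_mono) auto
      then have "err n \<omega> \<le> C * (sqrt K * a n + R + b n)" using bd[of \<omega>] \<omega> c by simp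
      also have "\<dots> \<le> C' * (R + a n + b n)"
      proof -
        have "0 \<le> C * (sqrt K * (R + b n) + a n)" using C K R nn by simp
        then show ?thesis by (simp add: C'_def algebra_simps)
      qed
      finally show ?thesis using R nn err_nonneg[of n \<omega>] by (simp add: R_def)
    qed
    ultimately show ?case using B(1) B12 by (intro bexI[of _ "B \<union> B1 \<union> B2"]) auto
  qed
  ultimately show "\<exists>K>0. \<forall>\<^sub>F n in sequentially. \<exists>B\<in>sets (M n). measure (M n) B \<le> \<eta> \<and>
      (\<forall>\<omega>\<in>space (M n) - B. \<bar>err n \<omega>\<bar> \<le> K * \<bar>\<rho> n * sqrt (r n) + a n + b n\<bar>)" by blast
qed

end

section \<open>Post-Lasso rates\<close>

text \<open>The infimum in \<open>oracle_err\<close> is attained at \<beta>, which turns cs into the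
  empirical norm of the approximation error, the form used in \<open>fixed_design\<close>.\<close>

lemma is_oracleD:
  assumes "is_oracle n p x f \<sigma> \<beta>"
  shows "\<beta> \<in> rvec p" "card (support \<beta>) \<le> oracle_index n p x f \<sigma>"
    "oracle_err n p x f (oracle_index n p x f \<sigma>) = emp_norm n (\<lambda>i. f i - dotp p (x i) \<beta>)"
proof -
  let ?A = "{\<beta> \<in> rvec p. l0 \<beta> \<le> oracle_index n p x f \<sigma>}"
  from assms have \<beta>: "\<beta> \<in> ?A" "\<And>b. b \<in> ?A \<Longrightarrow> lsq n p x f \<beta> \<le> lsq n p x f b"
    by (auto simp: is_oracle_def is_arg_min_linorder)
  then show "\<beta> \<in> rvec p" "card (support \<beta>) \<le> oracle_index n p x f \<sigma>"
    by (auto simp: l0_def)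
  have "(INF b\<in>?A. lsq n p x f b) = lsq n p x f \<beta>"
    by (rule cInf_eq_minimum) (use \<beta> in auto)
  then show "oracle_err n p x f (oracle_index n p x f \<sigma>) = emp_norm n (\<lambda>i. f i - dotp p (x i) \<beta>)"
    by (simp add: oracle_err_def emp_norm_def lsq_def)
qed

theorem corollary2:
  fixes M :: "nat \<Rightarrow> 'a measure"
    and p :: "nat \<Rightarrow> nat"
    and z :: "nat \<Rightarrow> nat \<Rightarrow> 'z"
    and f :: "nat \<Rightarrow> 'z \<Rightarrow> real"
    and P :: "nat \<Rightarrow> 'z \<Rightarrow> nat \<Rightarrow> real"
    and eps :: "nat \<Rightarrow> nat \<Rightarrow> 'a \<Rightarrow> real"
    and \<sigma> :: "nat \<Rightarrow> real"
    and sighat :: "nat \<Rightarrow> 'a \<Rightarrow> real"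
    and \<beta>0 :: "nat \<Rightarrow> nat \<Rightarrow> real"
    and \<beta>hat \<beta>til :: "nat \<Rightarrow> 'a \<Rightarrow> nat \<Rightarrow> real"
    and \<alpha> l u \<tau> :: "nat \<Rightarrow> real"
    and c c' cbar :: real
    and x :: "nat \<Rightarrow> nat \<Rightarrow> nat \<Rightarrow> real"
    and fv :: "nat \<Rightarrow> nat \<Rightarrow> real"
    and y :: "nat \<Rightarrow> 'a \<Rightarrow> nat \<Rightarrow> real"
    and s :: "nat \<Rightarrow> nat"
    and cs :: "nat \<Rightarrow> real"
    and T :: "nat \<Rightarrow> nat set"
    and lam :: "nat \<Rightarrow> 'a \<Rightarrow> real"
    and That :: "nat \<Rightarrow> 'a \<Rightarrow> nat set"
    and mhat :: "nat \<Rightarrow> 'a \<Rightarrow> nat"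
    and err :: "nat \<Rightarrow> 'a \<Rightarrow> real"
  defines "x \<equiv> \<lambda>n i. P n (z n i)"
    and "fv \<equiv> \<lambda>n i. f n (z n i)"
    and "y \<equiv> \<lambda>n \<omega> i. f n (z n i) + eps n i \<omega>"
    and "s \<equiv> \<lambda>n. oracle_index n (p n) (x n) (fv n) (\<sigma> n)"
    and "cs \<equiv> \<lambda>n. oracle_err n (p n) (x n) (fv n) (s n)"
    and "T \<equiv> \<lambda>n. support (\<beta>0 n)"
    and "lam \<equiv> \<lambda>n \<omega>. c' * sighat n \<omega> *
                  penalty_quantile (M n) n (p n) (x n) (eps n) (\<sigma> n) (1 - \<alpha> n)"
    and "That \<equiv> \<lambda>n \<omega>. support (\<beta>hat n \<omega>)"
    and "mhat \<equiv> \<lambda>n \<omega>. card (That n \<omega> - T n)"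
    and "err \<equiv> \<lambda>n \<omega>. emp_norm n (\<lambda>i. dotp (p n) (x n i) (\<beta>til n \<omega>) - fv n i)"
    and "cbar \<equiv> (c + 1) / (c - 1)"
  assumes prob_space: "\<And>n. n \<ge> 1 \<Longrightarrow> prob_space (M n)"
    and sigma_pos: "\<And>n. n \<ge> 1 \<Longrightarrow> \<sigma> n > 0"
    and eps_indep: "\<And>n. n \<ge> 1 \<Longrightarrow> prob_space.indep_vars (M n) (\<lambda>_. borel) (eps n) {1..n}"
    and eps_normal: "\<And>n i. n \<ge> 1 \<Longrightarrow> i \<in> {1..n} \<Longrightarrow>
          distributed (M n) lborel (eps n i) (normal_density 0 (\<sigma> n))"
    and normalized: "\<And>n j. n \<ge> 1 \<Longrightarrow> j \<in> {1..p n} \<Longrightarrow> En n (\<lambda>i. (x n i j)\<^sup>2) = 1"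
    and beta0: "\<And>n. n \<ge> 1 \<Longrightarrow> is_oracle n (p n) (x n) (fv n) (\<sigma> n) (\<beta>0 n)"
    and c_gt_1: "c > 1"
    and c'_gt_c: "c' > c"
    and l_u: "\<And>n. n \<ge> 1 \<Longrightarrow> 0 < l n \<and> l n \<le> 1 \<and> 1 \<le> u n"
    and tau: "\<And>n. n \<ge> 1 \<Longrightarrow> 0 \<le> \<tau> n \<and> \<tau> n < 1"
    and alpha: "\<And>n. n \<ge> 1 \<Longrightarrow> 0 < \<alpha> n \<and> \<alpha> n < 1"
    and c'_ge: "\<And>n. n \<ge> 1 \<Longrightarrow> c' \<ge> c / l n"
    and sighat_measurable: "\<And>n. n \<ge> 1 \<Longrightarrow> sighat n \<in> borel_measurable (M n)"
    and sighat: "\<And>n. n \<ge> 1 \<Longrightarrow>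
          measure (M n) {\<omega> \<in> space (M n). l n \<le> sighat n \<omega> / \<sigma> n \<and> sighat n \<omega> / \<sigma> n \<le> u n} \<ge> 1 - \<tau> n"
    and betahat_measurable: "\<And>n j. n \<ge> 1 \<Longrightarrow> j \<in> {1..p n} \<Longrightarrow>
          (\<lambda>\<omega>. \<beta>hat n \<omega> j) \<in> borel_measurable (M n)"
    and betahat: "\<And>n \<omega>. n \<ge> 1 \<Longrightarrow> \<omega> \<in> space (M n) \<Longrightarrow>
          is_lasso n (p n) (x n) (y n \<omega>) (lam n \<omega>) (\<beta>hat n \<omega>)"
    and betatil_measurable: "\<And>n j. n \<ge> 1 \<Longrightarrow> j \<in> {1..p n} \<Longrightarrow>
          (\<lambda>\<omega>. \<beta>til n \<omega> j) \<in> borel_measurable (M n)"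
    and betatil: "\<And>n \<omega>. n \<ge> 1 \<Longrightarrow> \<omega> \<in> space (M n) \<Longrightarrow>
          is_post_ols n (p n) (x n) (y n \<omega>) (That n \<omega>) (\<beta>til n \<omega>)"
    and kappa_pos: "\<And>n. n \<ge> 1 \<Longrightarrow> restricted_eigenvalue n (p n) (x n) (s n) (T n) cbar > 0"
    and kappa_tilde_pos: "\<And>n. n \<ge> 1 \<Longrightarrow>
          AE \<omega> in M n. kappa_tilde n (p n) (x n) (T n) (mhat n \<omega>) > 0"
    and p_lim: "filterlim p at_top sequentially"
    and cs_bound: "lesssim (\<lambda>n. (cs n)\<^sup>2) (\<lambda>n. (\<sigma> n)\<^sup>2 * real (s n) / real n)"
    and phi_bound: "lesssim_as M (\<lambda>n \<omega>. phi n (p n) (x n) (T n) (mhat n \<omega>)) (\<lambda>_. 1)"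
    and kappa_bound: "lesssim (\<lambda>_. 1) (\<lambda>n. restricted_eigenvalue n (p n) (x n) (s n) (T n) cbar)"
    and mu_bound: "lesssim_as M (\<lambda>n \<omega>. mu n (p n) (x n) (T n) (mhat n \<omega>)) (\<lambda>_. 1)"
    and alpha_log: "lesssim (\<lambda>n. ln (1 / \<alpha> n)) (\<lambda>n. ln (real (p n)))"
    and alpha_lim: "\<alpha> \<longlonglongrightarrow> 0"
    and u_l_bound: "lesssim (\<lambda>n. u n / l n) (\<lambda>_. 1)"
    and tau_lim: "\<tau> \<longlonglongrightarrow> 0"
  shows "bigO_P M err (\<lambda>n. \<sigma> n * sqrt (real (s n) * ln (real (p n)) / real n) + cs n)
    \<and> (smallo_P M (\<lambda>n \<omega>. real (mhat n \<omega>)) (\<lambda>n. real (s n)) \<and> wpa1 M (\<lambda>n \<omega>. T n \<subseteq> That n \<omega>)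
        \<longrightarrow> (\<exists>r :: nat \<Rightarrow> real. (\<forall>n. 0 \<le> r n) \<and> r \<in> o(\<lambda>n. real (s n)) \<and>
              bigO_P M err (\<lambda>n. \<sigma> n * sqrt (r n * ln (real (p n)) / real n)
                                + \<sigma> n * sqrt (real (s n) / real n) + cs n)))
    \<and> (wpa1 M (\<lambda>n \<omega>. T n = That n \<omega>)
        \<longrightarrow> bigO_P M err (\<lambda>n. \<sigma> n * sqrt (real (s n) / real n) + cs n))"
proof -
  have y_eq: "y n \<omega> = (\<lambda>i. fv n i + eps n i \<omega>)" for n \<omega>
    by (simp add: y_def fv_def)
  have target: "\<beta>0 n \<in> rvec (p n)" "card (T n) \<le> s n"
    "cs n = emp_norm n (\<lambda>i. fv n i - dotp (p n) (x n i) (\<beta>0 n))" if "n \<ge> 1" for n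
    using is_oracleD[OF beta0[OF that]] by (simp_all add: T_def s_def cs_def)
  have sol: "\<beta>hat n \<omega> \<in> lasso_solutions n (p n) (x n) (y n \<omega>) (lam n \<omega>)"
    if "n \<ge> 1" "\<omega> \<in> space (M n)" for n \<omega>
    using betahat[OF that] by (simp add: is_lasso_def is_arg_min_def)
  have That_sub: "That n \<omega> \<subseteq> {1..p n}" if "n \<ge> 1" "\<omega> \<in> space (M n)" for n \<omega>
    using sol[OF that] rvec_finite_support
    by (auto simp: That_def lasso_solutions_def is_arg_min_def)
  have T_sub: "T n \<subseteq> {1..p n}" if "n \<ge> 1" for n
    using target(1)[OF that] rvec_finite_support by (auto simp: T_def)
  have pr: "prob_space (M n)" if "n \<ge> 1" for n by (rule prob_space[OF that])

  have That_iff: "T n \<subseteq> That n \<omega> \<longleftrightarrow> (\<forall>j\<in>T n. \<beta>hat n \<omega> j \<noteq> 0)" for n \<omega>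
    by (auto simp: That_def support_def)
  \<comment> \<open>A cardinality of a random set becomes a finite sum of indicators over fixed
    coordinates, which gives measurability.\<close>
  have mhat_sum: "real (mhat n \<omega>) = (\<Sum>j\<in>{1..p n} - T n. if \<beta>hat n \<omega> j \<noteq> 0 then 1 else 0)"
    if "n \<ge> 1" "\<omega> \<in> space (M n)" for n \<omega>
  proof -
    have "That n \<omega> - T n = {j \<in> {1..p n} - T n. \<beta>hat n \<omega> j \<noteq> 0}"
      using That_sub[OF that] by (auto simp: That_def support_def)
    then show ?thesis by (simp add: mhat_def sum.inter_filter[symmetric])
  qed
  have mhat_meas: "(\<lambda>\<omega>. real (mhat n \<omega>)) \<in> borel_measurable (M n)" if "n \<ge> 1" for n
  proof -
    have [measurable]: "j \<in> {1..p n} - T n \<Longrightarrow> (\<lambda>\<omega>. \<beta>hat n \<omega> j) \<in> borel_measurable (M n)" for j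
      using betahat_measurable[OF that] by simp
    have "(\<lambda>\<omega>. \<Sum>j\<in>{1..p n} - T n. if \<beta>hat n \<omega> j \<noteq> 0 then 1 else 0 :: real) \<in> borel_measurable (M n)"
      by (intro borel_measurable_sum) measurable
    then show ?thesis by (subst measurable_cong[OF mhat_sum[OF that]])
  qed
  have Cov_meas: "{\<omega> \<in> space (M n). T n \<subseteq> That n \<omega>} \<in> sets (M n)" if "n \<ge> 1" for n
  proof -
    have [measurable]: "j \<in> T n \<Longrightarrow> (\<lambda>\<omega>. \<beta>hat n \<omega> j) \<in> borel_measurable (M n)" for j
      using betahat_measurable[OF that] T_sub[OF that] by auto
    have "finite (T n)" using T_sub[OF that] finite_subset by blast
    then show ?thesis unfolding That_iff by measurable
  qed

  obtain Cs where Cs: "Cs > 0"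
    "\<forall>\<^sub>F n in sequentially. (cs n)\<^sup>2 \<le> Cs * ((\<sigma> n)\<^sup>2 * real (s n) / real n)"
    using cs_bound by (auto simp: lesssim_def)
  obtain C\<phi> where C\<phi>: "C\<phi> > 0"
    "\<forall>\<^sub>F n in sequentially. AE \<omega> in M n. phi n (p n) (x n) (T n) (mhat n \<omega>) \<le> C\<phi>"
    using phi_bound by (auto simp: lesssim_as_def)
  obtain C\<mu> where C\<mu>: "C\<mu> > 0"
    "\<forall>\<^sub>F n in sequentially. AE \<omega> in M n. mu n (p n) (x n) (T n) (mhat n \<omega>) \<le> C\<mu>"
    using mu_bound by (auto simp: lesssim_as_def)
  obtain C\<kappa> where C\<kappa>: "C\<kappa> > 0"
    "\<forall>\<^sub>F n in sequentially. 1 \<le> C\<kappa> * restricted_eigenvalue n (p n) (x n) (s n) (T n) cbar"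
    using kappa_bound by (auto simp: lesssim_def)
  obtain C\<alpha> where C\<alpha>: "C\<alpha> > 0"
    "\<forall>\<^sub>F n in sequentially. ln (1 / \<alpha> n) \<le> C\<alpha> * ln (real (p n))"
    using alpha_log unfolding lesssim_def by blast
  obtain Cu where Cu: "Cu > 0" "\<forall>\<^sub>F n in sequentially. u n / l n \<le> Cu"
    using u_l_bound by (auto simp: lesssim_def)
  have ln_p: "\<forall>\<^sub>F n in sequentially. 1 \<le> ln (real (p n))"
    using filterlim_at_top[THEN iffD1, OF p_lim, rule_format, of 3]
  proof eventually_elim
    case (elim n)
    then have "exp 1 \<le> real (p n)" using exp_le by linarith
    with elim show ?case by (simp add: ln_ge_iff)
  qed
  have \<alpha>_half: "\<forall>\<^sub>F n in sequentially. \<alpha> n \<le> 1 / 2"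
    using order_tendstoD(2)[OF alpha_lim, of "1 / 2"] by (simp add: eventually_mono less_imp_le)

  define G where "G = sqrt (8 * (2 + C\<alpha>))"
  \<comment> \<open>\<open>H\<close> and \<open>W\<close> are the constants of
    \<open>post_lasso_event\<close> at \<open>k0 = 1 / C\<kappa>\<close>, the eventual lower bound
    for the restricted eigenvalue.\<close>
  define H where "H = 2 * c * sqrt C\<phi> * (2 / (1 / C\<kappa>) + 3 * sqrt Cs) / (c - 1)"
  define W where "W = c' * Cu * G / (1 / C\<kappa>)"
  have pos: "0 \<le> G" "0 \<le> H" "0 \<le> W"
    using C\<alpha>(1) C\<phi>(1) C\<kappa>(1) Cs(1) Cu(1) c_gt_1 c'_gt_c by (simp_all add: G_def H_def W_def)
  \<comment> \<open>A sum of nonnegative terms dominates each of them. The 4 covers three cs and the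
    additional one of the uncovered case.\<close>
  define C where "C = H + 2 * C\<mu> + C\<mu> * G + 4 + 2 * W"
  have Cge: "H \<le> C" "2 * C\<mu> \<le> C" "C\<mu> * G \<le> C" "4 \<le> C" "2 * W \<le> C" "0 < C"
    using pos C\<mu>(1) by (simp_all add: C_def add_pos_nonneg)
  define a where "a = (\<lambda>n. \<sigma> n * sqrt (real (s n) / real n))"
  define \<rho> where "\<rho> = (\<lambda>n. \<sigma> n * sqrt (ln (real (p n)) / real n))"
  have \<rho>_sqrt: "\<rho> n * sqrt t = \<sigma> n * sqrt (t * ln (real (p n)) / real n)" for n t
    by (simp add: \<rho>_def real_sqrt_mult real_sqrt_divide)
  have cs0: "0 \<le> cs n" if "n \<ge> 1" for n using target(3)[OF that] by simp
  have a0: "0 \<le> a n" and \<rho>0: "0 \<le> \<rho> n" if "n \<ge> 1" for n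
  proof -
    show "0 \<le> a n" using sigma_pos[OF that] by (simp add: a_def)
    have "0 \<le> ln (real (p n))" by (cases "p n = 0") auto
    then show "0 \<le> \<rho> n" using sigma_pos[OF that] by (simp add: \<rho>_def)
  qed

  interpret SB: stochastic_bound M err "\<lambda>n \<omega>. real (mhat n \<omega>)" "\<lambda>n \<omega>. T n \<subseteq> That n \<omega>"
    a \<rho> cs "\<lambda>n. real (s n)" "\<lambda>n. \<alpha> n + \<tau> n" C
  proof (rule stochastic_bound.intro)
    show "0 \<le> err n \<omega>" for n \<omega> by (simp add: err_def)
    show "\<forall>\<^sub>F n in sequentially. a n \<le> \<rho> n * sqrt (real (s n))"
      using ln_p eventually_ge_at_top[of 1]
    proof eventually_elim
      case (elim n)
      have "real (s n) * 1 / real n \<le> real (s n) * ln (real (p n)) / real n"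
        using elim by (intro divide_right_mono mult_left_mono) auto
      then show ?case
        unfolding \<rho>_sqrt a_def using sigma_pos[OF elim(2)] by (intro mult_left_mono) auto
    qed
    show "(\<lambda>n. \<alpha> n + \<tau> n) \<longlonglongrightarrow> 0" using tendsto_add[OF alpha_lim tau_lim] by simp
    fix K :: real assume K: "0 < K"
    show "\<forall>\<^sub>F n in sequentially. \<exists>B\<in>sets (M n). measure (M n) B \<le> \<alpha> n + \<tau> n + 1 / K \<and>
        (\<forall>\<omega>\<in>space (M n) - B. sqrt (real (mhat n \<omega>)) \<le> C * sqrt (real (s n)) \<and>
          err n \<omega> \<le> C * (sqrt K * a n + sqrt (real (mhat n \<omega>)) * \<rho> n + cs n)
            + (if T n \<subseteq> That n \<omega> then 0 else C * (\<rho> n * sqrt (real (s n)))))"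
      using Cs(2) C\<phi>(2) C\<mu>(2) C\<kappa>(2) C\<alpha>(2) Cu(2) ln_p \<alpha>_half eventually_ge_at_top[of 1]
    proof eventually_elim
      case (elim n)
      note n = \<open>1 \<le> n\<close>
      \<comment> \<open>\<open>ln 0\<close> is 0 by convention, so \<open>1 \<le> ln p\<close> rules
        out p = 0.\<close>
      have "1 \<le> p n"
      proof (rule ccontr)
        assume "\<not> 1 \<le> p n"
        then have "p n = 0" by simp
        with elim(7) show False by simp
      qed
      then interpret gaussian_design "M n" n "p n" "x n" "eps n" "\<sigma> n"
        using n sigma_pos[OF n] eps_indep[OF n] eps_normal[OF n] normalized[OF n] pr[OF n]
        by (intro gaussian_design.intro gaussian_design_axioms.intro) auto
      have ln: "0 < l n" "l n \<le> 1" "c / l n \<le> c'" using l_u[OF n] c'_ge[OF n] by auto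
      have k0: "1 / C\<kappa> \<le> restricted_eigenvalue n (p n) (x n) (s n) (T n) ((c + 1) / (c - 1))"
        using elim(4) C\<kappa>(1) by (simp add: cbar_def divide_le_eq mult.commute)
      have T: "T n = support (\<beta>0 n)" by (simp add: T_def)
      have \<alpha>n: "0 < \<alpha> n" using alpha[OF n] by simp
      have \<kappa>n: "0 < 1 / C\<kappa>" using C\<kappa>(1) by simp
      have lasso: "\<beta>hat n \<omega> \<in> lasso_solutions n (p n) (x n) (\<lambda>i. fv n i + eps n i \<omega>)
          (c' * sighat n \<omega> * \<Lambda> (1 - \<alpha> n))" if "\<omega> \<in> space (M n)" for \<omega>
        using sol[OF n that] unfolding y_eq lam_def .
      have post: "is_post_ols n (p n) (x n) (\<lambda>i. fv n i + eps n i \<omega>) (support (\<beta>hat n \<omega>)) (\<beta>til n \<omega>)"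
        if "\<omega> \<in> space (M n)" for \<omega>
        using betatil[OF n that] unfolding y_eq That_def .
      have eigen: "AE \<omega> in M n. 0 < kappa_tilde n (p n) (x n) (T n) (card (support (\<beta>hat n \<omega>) - T n))"
        "AE \<omega> in M n. phi n (p n) (x n) (T n) (card (support (\<beta>hat n \<omega>) - T n)) \<le> C\<phi>"
        "AE \<omega> in M n. mu n (p n) (x n) (T n) (card (support (\<beta>hat n \<omega>) - T n)) \<le> C\<mu>"
        using kappa_tilde_pos[OF n] elim(2,3) unfolding mhat_def That_def by auto
      have \<rho>n: "\<rho> n = \<sigma> n * sqrt (ln (real (p n)) / real n)" by (simp add: \<rho>_def)
      have "\<exists>B\<in>events. prob B \<le> \<alpha> n + \<tau> n + 1 / K \<and>
        (\<forall>\<omega>\<in>space (M n) - B. sqrt (real (mhat n \<omega>)) \<le> H * sqrt (real (s n)) \<and>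
          err n \<omega> \<le> C\<mu> * (2 * sqrt K * a n + sqrt (real (mhat n \<omega>)) * (G * \<rho> n)) + 3 * cs n
            + (if T n \<subseteq> That n \<omega> then 0 else 2 * W * (\<rho> n * sqrt (real (s n))) + cs n))"
        unfolding err_def mhat_def That_def H_def W_def a_def
        by (rule post_lasso_event[OF target(1)[OF n] T target(2,3)[OF n] elim(1) less_imp_le[OF Cs(1)]
              \<alpha>n elim(8) c_gt_1 ln elim(6) sighat_measurable[OF n] sighat[OF n] lasso post \<kappa>n k0
              eigen(1,2) less_imp_le[OF C\<phi>(1)] eigen(3) less_imp_le[OF C\<mu>(1)] elim(7,5) G_def K \<rho>n])
      then obtain B where B: "B \<in> events" "prob B \<le> \<alpha> n + \<tau> n + 1 / K"
        and bd: "\<forall>\<omega>\<in>space (M n) - B. sqrt (real (mhat n \<omega>)) \<le> H * sqrt (real (s n)) \<and>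
          err n \<omega> \<le> C\<mu> * (2 * sqrt K * a n + sqrt (real (mhat n \<omega>)) * (G * \<rho> n)) + 3 * cs n
            + (if T n \<subseteq> That n \<omega> then 0 else 2 * W * (\<rho> n * sqrt (real (s n))) + cs n)"
        by blast
      show ?case
      proof (intro bexI[OF _ B(1)] conjI B(2) ballI)
        fix \<omega> assume \<omega>: "\<omega> \<in> space (M n) - B"
        note bd\<omega> = bspec[OF bd \<omega>]
        let ?m = "sqrt (real (mhat n \<omega>))" and ?R = "\<rho> n * sqrt (real (s n))"
        have nn: "0 \<le> sqrt K * a n" "0 \<le> ?m * \<rho> n" "0 \<le> ?R" "0 \<le> cs n"
          using K a0[OF n] \<rho>0[OF n] cs0[OF n] by auto
        have "H * sqrt (real (s n)) \<le> C * sqrt (real (s n))" by (intro mult_right_mono Cge) auto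
        then show "?m \<le> C * sqrt (real (s n))" using bd\<omega> by linarith
        have "C\<mu> * (2 * sqrt K * a n + ?m * (G * \<rho> n)) + 4 * cs n
            = 2 * C\<mu> * (sqrt K * a n) + C\<mu> * G * (?m * \<rho> n) + 4 * cs n"
          by (simp add: algebra_simps)
        also have "\<dots> \<le> C * (sqrt K * a n) + C * (?m * \<rho> n) + C * cs n"
          using nn by (intro add_mono mult_right_mono Cge)
        finally have 1: "C\<mu> * (2 * sqrt K * a n + ?m * (G * \<rho> n)) + 4 * cs n
            \<le> C * (sqrt K * a n + ?m * \<rho> n + cs n)" by (simp add: algebra_simps)
        have 2: "2 * W * ?R \<le> C * ?R" using nn by (intro mult_right_mono Cge)
        show "err n \<omega> \<le> C * (sqrt K * a n + ?m * \<rho> n + cs n) + (if T n \<subseteq> That n \<omega> then 0 else C * ?R)"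
          using bd\<omega> 1 2 nn(4) by (auto split: if_splits)
      qed
    qed
  qed (simp_all add: pr mhat_meas Cov_meas a0 \<rho>0 cs0 Cge(6))

  show ?thesis
  proof (intro conjI impI)
    show "bigO_P M err (\<lambda>n. \<sigma> n * sqrt (real (s n) * ln (real (p n)) / real n) + cs n)"
      using SB.general_rate by (simp add: \<rho>_sqrt)
  next
    assume A: "smallo_P M (\<lambda>n \<omega>. real (mhat n \<omega>)) (\<lambda>n. real (s n)) \<and> wpa1 M (\<lambda>n \<omega>. T n \<subseteq> That n \<omega>)"
    obtain r where r: "\<And>n. 0 \<le> r n" "r \<in> o(\<lambda>n. real (s n))"
      "(\<lambda>n. measure (M n) {\<omega> \<in> space (M n). real (mhat n \<omega>) > r n}) \<longlonglongrightarrow> 0"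
      using smallo_P_deterministic_rate[OF pr mhat_meas conjunct1[OF A]] by auto
    have "bigO_P M err (\<lambda>n. \<sigma> n * sqrt (r n * ln (real (p n)) / real n)
        + \<sigma> n * sqrt (real (s n) / real n) + cs n)"
      using SB.covering_rate[OF r(3,1) conjunct2[OF A]] unfolding \<rho>_sqrt a_def .
    with r(1,2) show "\<exists>r. (\<forall>n. 0 \<le> r n) \<and> r \<in> o(\<lambda>n. real (s n)) \<and>
        bigO_P M err (\<lambda>n. \<sigma> n * sqrt (r n * ln (real (p n)) / real n)
          + \<sigma> n * sqrt (real (s n) / real n) + cs n)" by blast
  next
    assume A: "wpa1 M (\<lambda>n \<omega>. T n = That n \<omega>)"
    have eq_meas: "{\<omega> \<in> space (M n). T n = That n \<omega>} \<in> sets (M n)" if n: "n \<ge> 1" for n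
    proof -
      \<comment> \<open>Equality is inclusion together with mhat = 0; both events are known to be
        measurable.\<close>
      have "{\<omega> \<in> space (M n). T n = That n \<omega>}
          = {\<omega> \<in> space (M n). T n \<subseteq> That n \<omega>} \<inter> {\<omega> \<in> space (M n). real (mhat n \<omega>) \<le> 0}"
        using That_sub[OF n] finite_subset[OF That_sub[OF n]] by (auto simp: mhat_def)
      also have "\<dots> \<in> sets (M n)"
        using mhat_meas[OF n] Cov_meas[OF n] by measurable
      finally show ?thesis .
    qed
    have compl: "(\<lambda>n. measure (M n) {\<omega> \<in> space (M n). T n \<noteq> That n \<omega>}) \<longlonglongrightarrow> 0"
      by (rule wpa1_complement[OF pr eq_meas A])
    \<comment> \<open>T = That forces mhat = 0, so \<open>covering_rate\<close> applies with r = 0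
      and its logarithmic term vanishes.\<close>
    have m0: "(\<lambda>n. measure (M n) {\<omega> \<in> space (M n). real (mhat n \<omega>) > 0}) \<longlonglongrightarrow> 0"
    proof (rule tendsto_sandwich[OF _ _ tendsto_const compl])
      show "\<forall>\<^sub>F n in sequentially. measure (M n) {\<omega> \<in> space (M n). real (mhat n \<omega>) > 0}
          \<le> measure (M n) {\<omega> \<in> space (M n). T n \<noteq> That n \<omega>}"
      proof (rule eventually_sequentiallyI[of 1])
        fix n :: nat assume n: "1 \<le> n"
        interpret prob_space "M n" by (rule pr[OF n])
        have [measurable]: "{\<omega> \<in> space (M n). T n = That n \<omega>} \<in> events" by (rule eq_meas[OF n])
        have "{\<omega> \<in> space (M n). T n \<noteq> That n \<omega>} \<in> events" by measurable
        then show "prob {\<omega> \<in> space (M n). real (mhat n \<omega>) > 0}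
            \<le> prob {\<omega> \<in> space (M n). T n \<noteq> That n \<omega>}"
          by (rule finite_measure_mono[rotated]) (auto simp: mhat_def)
      qed
    qed simp
    have "wpa1 M (\<lambda>n \<omega>. T n \<subseteq> That n \<omega>)"
      unfolding wpa1_def
    proof (rule tendsto_sandwich[OF _ _ A[unfolded wpa1_def] tendsto_const])
      show "\<forall>\<^sub>F n in sequentially. measure (M n) {\<omega> \<in> space (M n). T n = That n \<omega>}
          \<le> measure (M n) {\<omega> \<in> space (M n). T n \<subseteq> That n \<omega>}"
        by (rule eventually_sequentiallyI[of 1], rule finite_measure.finite_measure_mono)
           (use pr prob_space.axioms(1) Cov_meas in auto)
      show "\<forall>\<^sub>F n in sequentially. measure (M n) {\<omega> \<in> space (M n). T n \<subseteq> That n \<omega>} \<le> 1"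
        by (rule eventually_sequentiallyI[of 1]) (use pr prob_space.prob_le_1 in auto)
    qed
    then show "bigO_P M err (\<lambda>n. \<sigma> n * sqrt (real (s n) / real n) + cs n)"
      using SB.covering_rate[OF m0] by (simp add: a_def)
  qed
qed

end
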